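(* Let $X_1,\dots,X_n$ be i.i.d. from $P$ on $[0,1]^r$ with cdf $F$ and bounded density $p$, and let $B:=\log\sup_x p(x)>0$. Let $\rho$ be the Kolmogorov–Smirnov distance $\rho(F,G)=\sup_{t\in[0,1]^r}|F(t)-G(t)|$ and let $Z=(Z_1,\dots,Z_k)$ be drawn from the exponential mechanism based on $\rho$, with $k=k_n\asymp(3\alpha/B)^{2/3}n^{2/3}$. Then, with $\epsilon_n=2(B/(3\alpha))^{1/3}n^{-1/3}$, $$\rho(F,\hat F_Z)=O_P(\epsilon_n).$$
   Context: $\delta(x,y)=\#\{i:x_i\ne y_i\}$ is the Hamming distance between databases. For $u\in([0,1]^r)^\ell$, $\hat F_u$ denotes the empirical cdf of $u_1,\dots,u_\ell$ (componentwise order). Exponential mechanism based on $\rho$: with $\alpha>0$ and $\Delta_{n,k}=\sup_{x,y\in\mathcal X^n,\delta(x,y)=1}\sup_{z\in\mathcal X^k}|\rho(\hat F_x,\hat F_z)-\rho(\hat F_y,\hat F_z)|$, the output $Z\in\mathcal X^k$ has density (w.r.t. Lebesgue measure on $\mathcal X^k$) $h(z\mid x)=g_x(z)/\int_{\mathcal X^k}g_x(s)\,ds$ where $g_x(z)=\exp\big(-\alpha\rho(\hat F_x,\hat F_z)/(2\Delta_{n,k})\big)$. $O_P$ refers to the joint law of $X\sim P^n$ and $Z$; $a_n\asymp b_n$ means $a_n/b_n$ and $b_n/a_n$ are bounded for large $n$. *)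

theory Defs
  imports "HOL-Probability.Probability"
begin

definition unit_cube :: "(real ^ 'r) set" where
  "unit_cube = {x. \<forall>j. 0 \<le> x $ j \<and> x $ j \<le> 1}"

definition ecdf :: "nat \<Rightarrow> (nat \<Rightarrow> real ^ 'r) \<Rightarrow> real ^ 'r \<Rightarrow> real" where
  "ecdf l u t = real (card {i\<in>{..<l}. \<forall>j. u i $ j \<le> t $ j}) / real l"

definition ks_dist :: "(real ^ 'r \<Rightarrow> real) \<Rightarrow> (real ^ 'r \<Rightarrow> real) \<Rightarrow> real" where
  "ks_dist F G = (SUP t\<in>unit_cube. \<bar>F t - G t\<bar>)"

definition cdf_of :: "(real ^ 'r) measure \<Rightarrow> real ^ 'r \<Rightarrow> real" where
  "cdf_of P t = measure P {x. \<forall>j. x $ j \<le> t $ j}"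

definition hamming :: "nat \<Rightarrow> (nat \<Rightarrow> 'a) \<Rightarrow> (nat \<Rightarrow> 'a) \<Rightarrow> nat" where
  "hamming n x y = card {i\<in>{..<n}. x i \<noteq> y i}"

definition dbs :: "nat \<Rightarrow> (nat \<Rightarrow> real ^ 'r) set" where
  "dbs n = (\<Pi>\<^sub>E i\<in>{..<n}. unit_cube)"

definition sens :: "'r::finite itself \<Rightarrow> nat \<Rightarrow> nat \<Rightarrow> real" where
  "sens _ n k = (SUP (x, y, z) \<in> {(x, y, z). x \<in> (dbs n :: (nat \<Rightarrow> real ^ 'r) set) \<and> y \<in> dbs n
        \<and> hamming n x y = 1 \<and> z \<in> dbs k}.
      \<bar>ks_dist (ecdf n x) (ecdf k z) - ks_dist (ecdf n y) (ecdf k z)\<bar>)"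

definition g_exp :: "real \<Rightarrow> nat \<Rightarrow> nat \<Rightarrow> (nat \<Rightarrow> real ^ 'r) \<Rightarrow> (nat \<Rightarrow> real ^ 'r) \<Rightarrow> real" where
  "g_exp \<alpha> n k x z =
     exp (- \<alpha> * ks_dist (ecdf n x) (ecdf k z) / (2 * sens TYPE('r) n k))"

definition leb_k :: "nat \<Rightarrow> (nat \<Rightarrow> real ^ 'r) measure" where
  "leb_k k = PiM {..<k} (\<lambda>_. lborel)"

definition mech_prob :: "real \<Rightarrow> nat \<Rightarrow> nat \<Rightarrow> (nat \<Rightarrow> real ^ 'r) \<Rightarrow> (nat \<Rightarrow> real ^ 'r) set \<Rightarrow> ennreal" where
  "mech_prob \<alpha> n k x E =
     (\<integral>\<^sup>+ z. indicator (dbs k \<inter> E) z * ennreal (g_exp \<alpha> n k x z) \<partial>leb_k k)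
     / (\<integral>\<^sup>+ z. indicator (dbs k) z * ennreal (g_exp \<alpha> n k x z) \<partial>leb_k k)"

definition joint_prob :: "(real ^ 'r) measure \<Rightarrow> real \<Rightarrow> nat \<Rightarrow> nat \<Rightarrow> (nat \<Rightarrow> real ^ 'r) set \<Rightarrow> ennreal" where
  "joint_prob P \<alpha> n k E = (\<integral>\<^sup>+ x. mech_prob \<alpha> n k x E \<partial>(PiM {..<n} (\<lambda>_. P)))"

end

theory Submission
  imports Defs
begin

text \<open>
  The sensitivity of the Kolmogorov-Smirnov distance is exactly \<open>1/n\<close>, so the mechanism has weight
  \<open>exp (- \<alpha> n \<rho> / 2)\<close>. A sample of size \<open>m\<close> from \<open>P\<close> satisfies \<open>\<rho> \<le> C / sqrt m\<close> with high
  probability; this is shown by chaining over dyadic cells, whose probability is at most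
  \<open>e\<^sup>B\<close> times their volume. Applied with \<open>m = n\<close> it lets us replace the empirical distribution of the data by \<open>F\<close>.
  Applied with \<open>m = k\<close> it bounds the normalising integral from below: since the density of \<open>P\<^sup>k\<close> is at most
  \<open>e\<^bsup>k B\<^esup>\<close>, the outputs within \<open>C / sqrt k\<close> of \<open>F\<close> fill a volume of at least \<open>e\<^bsup>- k B\<^esup> / 2\<close>.
  Outputs at distance \<open>M \<epsilon>\<^sub>n\<close> or more then have conditional probability of order
  \<open>exp (k B - \<alpha> n (M \<epsilon>\<^sub>n - O (\<epsilon>\<^sub>n)) / 2)\<close>, and both \<open>k\<close> and \<open>n \<epsilon>\<^sub>n\<close> are of order \<open>n\<^bsup>2/3\<^esup>\<close>.
\<close>

section \<open>The Kolmogorov-Smirnov distance and its sensitivity\<close>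

lemma unit_cube_nonempty: "(0 :: real^'r) \<in> unit_cube"
  by (simp add: unit_cube_def)

lemma ecdf_bounds: "0 \<le> ecdf l u t" "ecdf l u t \<le> 1"
proof -
  have "card {i\<in>{..<l}. \<forall>j. u i $ j \<le> t $ j} \<le> card {..<l}"
    by (rule card_mono) auto
  then show "ecdf l u t \<le> 1"
    by (cases "l = 0") (auto simp: ecdf_def field_simps)
qed (simp add: ecdf_def)

lemma ecdf_bounded: "bounded (range (ecdf l u))"
  by (rule boundedI[of _ 1]) (use ecdf_bounds[of l u] in auto)

lemma cdf_of_bounded: "prob_space P \<Longrightarrow> bounded (range (cdf_of P))"
  by (rule boundedI[of _ 1]) (auto simp: cdf_of_def prob_space.prob_le_1)

lemma abs_diff_bdd_above:
  fixes F G :: "'a \<Rightarrow> real"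
  assumes "bounded (range F)" "bounded (range G)"
  shows "bdd_above ((\<lambda>t. \<bar>F t - G t\<bar>) ` S)"
proof -
  obtain a where a: "\<And>t. \<bar>F t\<bar> \<le> a"
    using assms(1) unfolding bounded_iff by auto
  obtain b where b: "\<And>t. \<bar>G t\<bar> \<le> b"
    using assms(2) unfolding bounded_iff by auto
  show ?thesis
  proof (rule bdd_aboveI2)
    fix t show "\<bar>F t - G t\<bar> \<le> a + b"
      using a[of t] b[of t] by linarith
  qed
qed

lemma ks_dist_le:
  assumes "\<And>t. t \<in> unit_cube \<Longrightarrow> \<bar>F t - G t\<bar> \<le> c"
  shows "ks_dist F G \<le> c"
  unfolding ks_dist_def by (rule cSUP_least) (use assms unit_cube_nonempty in auto)

lemma ks_dist_ge:
  assumes "bounded (range F)" "bounded (range G)" "t \<in> unit_cube"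
  shows "\<bar>F t - G t\<bar> \<le> ks_dist F G"
  unfolding ks_dist_def by (rule cSUP_upper[OF assms(3) abs_diff_bdd_above[OF assms(1,2)]])

lemma ks_dist_commute: "ks_dist F G = ks_dist G F"
  by (simp add: ks_dist_def abs_minus_commute)

lemma ks_dist_triangle:
  assumes "bounded (range F)" "bounded (range G)" "bounded (range H)"
  shows "ks_dist F H \<le> ks_dist F G + ks_dist G H"
proof (rule ks_dist_le)
  fix t :: "real^'a" assume t: "t \<in> unit_cube"
  show "\<bar>F t - H t\<bar> \<le> ks_dist F G + ks_dist G H"
    using ks_dist_ge[OF assms(1,2) t] ks_dist_ge[OF assms(2,3) t] by linarith
qed

text \<open>For each threshold the two counted index sets differ only inside the set of positions
  where the databases disagree.\<close>

lemma ks_dist_ecdf_hamming: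
  "ks_dist (ecdf n x) (ecdf n y) \<le> real (hamming n x y) / real n"
proof (rule ks_dist_le)
  fix t :: "real^'a"
  define S where "S w = {i\<in>{..<n}. \<forall>j. w i $ j \<le> t $ j}" for w :: "nat \<Rightarrow> real^'a"
  define H where "H = {i\<in>{..<n}. x i \<noteq> y i}"
  have fin: "finite H" "finite (S w)" for w by (auto simp: S_def H_def)
  have "card (S x) \<le> card (S y \<union> H)"
    by (rule card_mono) (use fin in \<open>auto simp: S_def H_def\<close>)
  also have "\<dots> \<le> card (S y) + card H" by (rule card_Un_le)
  finally have 1: "card (S x) \<le> card (S y) + card H" .
  have "card (S y) \<le> card (S x \<union> H)"
    by (rule card_mono) (use fin in \<open>auto simp: S_def H_def\<close>)
  also have "\<dots> \<le> card (S x) + card H" by (rule card_Un_le)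
  finally have 2: "card (S y) \<le> card (S x) + card H" .
  have "\<bar>real (card (S x)) - real (card (S y))\<bar> \<le> real (card H)"
    using 1 2 by linarith
  then have "\<bar>real (card (S x)) - real (card (S y))\<bar> / real n \<le> real (card H) / real n"
    by (rule divide_right_mono) simp
  then show "\<bar>ecdf n x t - ecdf n y t\<bar> \<le> real (hamming n x y) / real n"
    by (simp add: ecdf_def hamming_def S_def H_def abs_divide flip: diff_divide_distrib)
qed

lemma ecdf_const:
  "0 < l \<Longrightarrow> ecdf l (\<lambda>i\<in>{..<l}. a) t = (if \<forall>j. a $ j \<le> t $ j then 1 else 0)"
  by (auto simp: ecdf_def)

text \<open>The supremum is attained by the databases \<open>0, \<dots>, 0\<close> and \<open>1, 0, \<dots>, 0\<close> and the output \<open>1, \<dots>, 1\<close>.\<close>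

lemma sens_eq:
  assumes "0 < n" "0 < k"
  shows "sens TYPE('r::finite) n k = 1 / real n"
proof -
  define I where "I = {(x, y, z). x \<in> (dbs n :: (nat \<Rightarrow> real ^ 'r) set) \<and> y \<in> dbs n
        \<and> hamming n x y = 1 \<and> z \<in> (dbs k :: (nat \<Rightarrow> real ^ 'r) set)}"
  define f :: "(nat \<Rightarrow> real^'r) \<times> (nat \<Rightarrow> real^'r) \<times> (nat \<Rightarrow> real^'r) \<Rightarrow> real" where
    "f = (\<lambda>(x, y, z). \<bar>ks_dist (ecdf n x) (ecdf k z) - ks_dist (ecdf n y) (ecdf k z)\<bar>)"
  have sens: "sens TYPE('r) n k = (SUP w\<in>I. f w)"
    by (simp add: sens_def I_def f_def)
  have upper: "f w \<le> 1 / real n" if "w \<in> I" for w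
  proof -
    obtain x y z where w: "w = (x, y, z)" by (cases w)
    have h: "hamming n x y = 1" using that by (simp add: w I_def)
    have "ks_dist (ecdf n x) (ecdf n y) \<le> 1 / real n"
      using ks_dist_ecdf_hamming[of n x y] by (simp add: h)
    moreover have "ks_dist (ecdf n x) (ecdf k z) \<le> ks_dist (ecdf n x) (ecdf n y) + ks_dist (ecdf n y) (ecdf k z)"
      "ks_dist (ecdf n y) (ecdf k z) \<le> ks_dist (ecdf n y) (ecdf n x) + ks_dist (ecdf n x) (ecdf k z)"
      by (intro ks_dist_triangle ecdf_bounded)+
    ultimately show ?thesis
      by (simp add: w f_def ks_dist_commute[of "ecdf n y" "ecdf n x"])
  qed
  define x where "x = (\<lambda>i\<in>{..<n}. 0 :: real^'r)"
  define y where "y = (\<lambda>i\<in>{..<n}. if i = 0 then 1 else 0 :: real^'r)"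
  define z where "z = (\<lambda>i\<in>{..<k}. 1 :: real^'r)"
  \<comment> \<open>Inside the cube only the corner \<open>t = 1\<close> dominates the point
    \<open>1\<close>. Hence \<open>ecdf k z\<close> is the indicator of that corner, and away from
    it \<open>ecdf n y\<close> misses exactly one entry, a mass of \<open>1 / n\<close>.\<close>
  have one: "(\<forall>j. (1::real) \<le> t $ j) \<longleftrightarrow> t = 1" if "t \<in> unit_cube" for t :: "real^'r"
    using that by (auto simp: unit_cube_def vec_eq_iff intro: antisym)
  have x: "ecdf n x t = 1" if "t \<in> unit_cube" for t
    unfolding x_def using that by (subst ecdf_const[OF assms(1)]) (auto simp: unit_cube_def)
  have z: "ecdf k z t = (if t = 1 then 1 else 0)" if "t \<in> unit_cube" for t
    unfolding z_def using one[OF that] by (subst ecdf_const[OF assms(2)]) auto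
  have y: "ecdf n y t = (if t = 1 then 1 else (real n - 1) / real n)" if "t \<in> unit_cube" for t
  proof -
    have "{i\<in>{..<n}. \<forall>j. y i $ j \<le> t $ j} = (if t = 1 then {..<n} else {..<n} - {0})"
      using that one[OF that] by (auto simp: y_def unit_cube_def split: if_splits)
    then show ?thesis using assms(1) by (simp add: ecdf_def of_nat_diff)
  qed
  have "hamming n x y = 1"
  proof -
    have "{i\<in>{..<n}. x i \<noteq> y i} = {0}"
      using assms(1) by (auto simp: x_def y_def split: if_splits)
    then show ?thesis by (simp add: hamming_def)
  qed
  then have inI: "(x, y, z) \<in> I"
    by (auto simp: I_def dbs_def x_def y_def z_def unit_cube_def)
  \<comment> \<open>At the origin \<open>ecdf n x\<close> is \<open>1\<close> while
    \<open>ecdf k z\<close> is \<open>0\<close>; changing one entry lowers this distance by at least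
    \<open>1 / n\<close>.\<close>
  have "0 \<noteq> (1 :: real^'r)" by simp
  then have "1 \<le> ks_dist (ecdf n x) (ecdf k z)"
    using ks_dist_ge[OF ecdf_bounded[of n x] ecdf_bounded[of k z] unit_cube_nonempty]
    by (simp add: x z unit_cube_nonempty)
  moreover have "ks_dist (ecdf n y) (ecdf k z) \<le> (real n - 1) / real n"
    by (rule ks_dist_le) (use assms(1) in \<open>auto simp: y z\<close>)
  ultimately have "1 / real n \<le> f (x, y, z)"
    using assms(1) by (simp add: f_def diff_divide_distrib)
  then have "1 / real n \<le> (SUP w\<in>I. f w)"
    by (rule cSUP_upper2[rotated 2]) (use inI upper in \<open>auto intro!: bdd_aboveI2\<close>)
  moreover have "(SUP w\<in>I. f w) \<le> 1 / real n"
    by (rule cSUP_least) (use inI upper in auto)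
  ultimately show ?thesis by (simp add: sens)
qed

section \<open>Deviations of counts\<close>

text \<open>Serves to replace \<open>exp s - 1 - s\<close> by \<open>s^2\<close> in moment
  generating functions. For negative \<open>s = - t\<close> the claim amounts to
  \<open>1 \<le> (1 - t + t^2) * exp t\<close>, which follows from the quadratic Taylor lower bound
  of \<open>exp t\<close>.\<close>

lemma exp_le_quadratic:
  fixes s :: real
  assumes "\<bar>s\<bar> \<le> 1"
  shows "exp s \<le> 1 + s + s\<^sup>2"
proof (cases "0 \<le> s")
  case True
  then show ?thesis using exp_bound[of s] assms by simp
next
  case False
  define t where "t = - s"
  have t: "0 \<le> t" "t \<le> 1" using False assms by (auto simp: t_def)
  have "1 \<le> (1 - t + t\<^sup>2) * (1 + t + t\<^sup>2 / 2)"
  proof -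
    have "(1 - t + t\<^sup>2) * (1 + t + t\<^sup>2 / 2) = 1 + t\<^sup>2 / 2 + t^3 / 2 + t^4 / 2"
      by (simp add: field_simps power2_eq_square power3_eq_cube power4_eq_xxxx)
    then show ?thesis using t by simp
  qed
  also have "\<dots> \<le> (1 - t + t\<^sup>2) * exp t"
    by (rule mult_left_mono[OF exp_lower_Taylor_quadratic]) (use t in auto)
  finally have "exp (- t) \<le> 1 - t + t\<^sup>2"
    by (simp add: exp_minus field_simps)
  then show ?thesis by (simp add: t_def)
qed

text \<open>With \<open>q = measure M A\<close>, the Bernoulli moment
  \<open>1 + (exp s - 1) * q\<close> is at most \<open>exp ((exp s - 1) * q)\<close>. Keeping the
  factor \<open>q\<close> in the exponent, rather than a constant as in Hoeffding's bound, is what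
  gives small cells small deviations.\<close>

lemma indicator_exp_moment:
  assumes "prob_space M" "A \<in> sets M" "\<bar>s\<bar> \<le> 1"
  shows "(\<integral>\<^sup>+ x. ennreal (exp (s * (indicator A x - measure M A))) \<partial>M)
    \<le> ennreal (exp (s\<^sup>2 * measure M A))"
proof -
  interpret prob_space M by fact
  define q where "q = measure M A"
  have int: "integrable M (indicat_real A)"
    using assms(2) by (intro integrable_real_indicator) (auto simp: less_top[symmetric])
  \<comment> \<open>The exponential of a two-valued function is affine in the indicator, so its
    integral is explicit.\<close>
  have eq: "exp (s * (indicator A x - q)) = exp (- s * q) * (1 + (exp s - 1) * indicator A x)" for x
    by (simp add: indicator_def algebra_simps flip: exp_add)
  have "(\<integral>\<^sup>+ x. ennreal (exp (s * (indicator A x - q))) \<partial>M)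
      = ennreal (\<integral>x. exp (- s * q) * (1 + (exp s - 1) * indicator A x) \<partial>M)"
    unfolding eq
  proof (rule nn_integral_eq_integral)
    show "integrable M (\<lambda>x. exp (- s * q) * (1 + (exp s - 1) * indicator A x))"
      using int by simp
    show "AE x in M. 0 \<le> exp (- s * q) * (1 + (exp s - 1) * indicator A x)"
      unfolding eq[symmetric] by simp
  qed
  also have "(\<integral>x. exp (- s * q) * (1 + (exp s - 1) * indicator A x) \<partial>M)
      = exp (- s * q) * (1 + (exp s - 1) * q)"
    using int by (simp add: q_def prob_space assms(2))
  also have "\<dots> \<le> exp (- s * q) * exp ((exp s - 1) * q)"
    by (intro mult_left_mono exp_ge_add_one_self) simp
  also have "\<dots> = exp ((exp s - 1 - s) * q)"
    by (simp add: algebra_simps flip: exp_add)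
  also have "\<dots> \<le> exp (s\<^sup>2 * q)"
    using exp_le_quadratic[OF assms(3)] by (simp add: q_def mult_right_mono)
  finally show ?thesis by (simp add: q_def ennreal_leI)
qed

lemma count_exp_moment:
  assumes "prob_space M" "A \<in> sets M" "\<bar>s\<bar> \<le> 1"
  shows "(\<integral>\<^sup>+ x. ennreal (exp (s * (\<Sum>i<n. indicator A (x i) - measure M A))) \<partial>PiM {..<n::nat} (\<lambda>_. M))
    \<le> ennreal (exp (n * (s\<^sup>2 * measure M A)))"
proof -
  interpret prob_space M by fact
  interpret product_sigma_finite "\<lambda>_::nat. M" ..
  have "(\<integral>\<^sup>+ x. ennreal (exp (s * (\<Sum>i<n. indicator A (x i) - measure M A))) \<partial>PiM {..<n} (\<lambda>_. M))
    = (\<integral>\<^sup>+ x. (\<Prod>i<n. ennreal (exp (s * (indicator A (x i) - measure M A)))) \<partial>PiM {..<n} (\<lambda>_. M))"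
    by (simp add: sum_distrib_left exp_sum prod_ennreal del: of_nat_Suc)
  also have "\<dots> = (\<Prod>i<n. \<integral>\<^sup>+ x. ennreal (exp (s * (indicator A x - measure M A))) \<partial>M)"
    using assms(2) by (intro product_nn_integral_prod) auto
  also have "\<dots> \<le> (\<Prod>i<n. ennreal (exp (s\<^sup>2 * measure M A)))"
    by (intro prod_mono_ennreal indicator_exp_moment assms)
  also have "\<dots> = ennreal (exp (n * (s\<^sup>2 * measure M A)))"
    by (simp add: prod_ennreal ennreal_power exp_of_nat_mult)
  finally show ?thesis .
qed

text \<open>Chernoff bound with \<open>s\<close> left free, to be tuned later to the size of the
  cell; independence enters through \<open>count_exp_moment\<close>.\<close>

lemma count_deviation:
  assumes M: "prob_space M" and A: "A \<in> sets M" and s: "0 \<le> s" "s \<le> 1"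
  shows "emeasure (PiM {..<n::nat} (\<lambda>_. M))
      {x \<in> space (PiM {..<n} (\<lambda>_. M)). u < \<bar>\<Sum>i<n. indicator A (x i) - measure M A\<bar>}
    \<le> ennreal (2 * exp (n * (s\<^sup>2 * measure M A) - s * u))"
proof -
  interpret prob_space M by fact
  let ?N = "PiM {..<n} (\<lambda>_. M)"
  define T where "T x = (\<Sum>i<n. indicator A (x i) - measure M A)" for x
  have [measurable]: "A \<in> sets M" by (rule A)
  have [measurable]: "T \<in> borel_measurable ?N"
    unfolding T_def by measurable
  \<comment> \<open>The sign \<open>\<sigma>\<close> selects the tail; the moment bound depends only
    on the square of \<open>s * \<sigma>\<close>, so both tails get the same estimate.\<close>
  have tail: "emeasure ?N {x \<in> space ?N. u < \<sigma> * T x} \<le> ennreal (exp (n * (s\<^sup>2 * measure M A) - s * u))"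
    if "\<sigma> = 1 \<or> \<sigma> = -1" for \<sigma> :: real
  proof -
    have "emeasure ?N {x \<in> space ?N. u < \<sigma> * T x}
        = (\<integral>\<^sup>+ x. indicator {x \<in> space ?N. u < \<sigma> * T x} x \<partial>?N)"
      by (rule nn_integral_indicator[symmetric]) measurable
    also have "\<dots> \<le> (\<integral>\<^sup>+ x. ennreal (exp (- s * u)) * ennreal (exp (s * \<sigma> * T x)) \<partial>?N)"
    proof (rule nn_integral_mono)
      fix x
      have "1 \<le> exp (s * (\<sigma> * T x - u))" if "u < \<sigma> * T x"
        using that s by simp
      then show "indicator {x \<in> space ?N. u < \<sigma> * T x} x
          \<le> ennreal (exp (- s * u)) * ennreal (exp (s * \<sigma> * T x))"
        by (auto simp: indicator_def algebra_simps simp flip: ennreal_mult exp_add ennreal_1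
              intro!: ennreal_leI)
    qed
    also have "\<dots> = ennreal (exp (- s * u)) * (\<integral>\<^sup>+ x. ennreal (exp (s * \<sigma> * T x)) \<partial>?N)"
      by (rule nn_integral_cmult) measurable
    also have "\<dots> \<le> ennreal (exp (- s * u)) * ennreal (exp (n * ((s * \<sigma>)\<^sup>2 * measure M A)))"
      unfolding T_def by (intro mult_left_mono count_exp_moment M A) (use that s in auto)
    also have "\<dots> = ennreal (exp (n * (s\<^sup>2 * measure M A) - s * u))"
      using that by (auto simp: algebra_simps simp flip: ennreal_mult exp_add)
    finally show ?thesis .
  qed
  have "{x \<in> space ?N. u < \<bar>T x\<bar>} = {x \<in> space ?N. u < 1 * T x} \<union> {x \<in> space ?N. u < - 1 * T x}"
    by auto
  then have "emeasure ?N {x \<in> space ?N. u < \<bar>T x\<bar>}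
      \<le> emeasure ?N {x \<in> space ?N. u < 1 * T x} + emeasure ?N {x \<in> space ?N. u < - 1 * T x}"
    by (simp only:) (rule emeasure_subadditive; measurable)
  also have "\<dots> \<le> ennreal (exp (n * (s\<^sup>2 * measure M A) - s * u)) + ennreal (exp (n * (s\<^sup>2 * measure M A) - s * u))"
    by (intro add_mono tail) auto
  also have "\<dots> = ennreal (2 * exp (n * (s\<^sup>2 * measure M A) - s * u))"
    by (simp flip: ennreal_plus)
  finally show ?thesis by (simp add: T_def)
qed

section \<open>Dyadic cells\<close>

text \<open>Dropping the last binary digit preserves \<open>c < b\<close> except when
  \<open>b\<close> is odd and \<open>c\<close> is its even predecessor. The two cases exclude each
  other, so the indicators add.\<close>

lemma less_split_halves:
  fixes c b :: nat
  shows "(of_bool (c < b) :: real) = of_bool (c div 2 < b div 2) + of_bool (odd b \<and> c = b - 1)"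
proof -
  have "c < b \<longleftrightarrow> c div 2 < b div 2 \<or> (odd b \<and> c = b - 1)"
    "\<not> (c div 2 < b div 2 \<and> odd b \<and> c = b - 1)"
    by presburger+
  then show ?thesis by (auto simp: of_bool_def)
qed

lemma less_dyadic_sum_aux:
  fixes c b :: nat
  shows "(of_bool (c < b) :: real) = of_bool (c div 2 ^ S < b div 2 ^ S) +
    (\<Sum>s<S. of_bool (odd (b div 2 ^ s) \<and> c div 2 ^ s = b div 2 ^ s - 1))"
proof (induction S)
  case (Suc S)
  show ?case
    using less_split_halves[of "c div 2 ^ S" "b div 2 ^ S"]
    by (simp only: Suc.IH sum.lessThan_Suc power_Suc2 div_mult2_eq)
qed simp

text \<open>Splits the initial segment below \<open>b\<close> into disjoint dyadic blocks, one for
  each binary digit \<open>1\<close> of \<open>b\<close>. The assumption makes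
  \<open>b div 2 ^ S\<close> vanish, so no coarse remainder is left.\<close>

lemma less_dyadic_sum:
  fixes c b :: nat
  assumes "b < 2 ^ S"
  shows "(of_bool (c < b) :: real) =
    (\<Sum>s<S. of_bool (odd (b div 2 ^ s)) * of_bool (c div 2 ^ s = b div 2 ^ s - 1))"
  using assms less_dyadic_sum_aux[of c b S] by (simp add: of_bool_conj)

text \<open>\<open>nat\<close> sends negative values to \<open>0\<close>, so cells with index
  \<open>0\<close> extend to minus infinity and grid orthants are genuine lower orthants. Volumes
  are therefore taken only after intersecting with \<open>unit_cube\<close>.\<close>

definition cell_index :: "nat \<Rightarrow> real ^ 'r \<Rightarrow> 'r \<Rightarrow> nat" where
  "cell_index J x i = nat \<lfloor>2 ^ J * x $ i\<rfloor>"

text \<open>Each coordinate has its own scale: merging \<open>2 ^ s i\<close> consecutive fine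
  intervals gives side length \<open>2 ^ s i / 2 ^ J\<close> in the cube, so \<open>s i = 0\<close>
  is the finest scale.\<close>

definition dyadic_cell :: "nat \<Rightarrow> ('r \<Rightarrow> nat) \<Rightarrow> ('r \<Rightarrow> nat) \<Rightarrow> (real ^ 'r) set" where
  "dyadic_cell J s m = {x. \<forall>i. cell_index J x i div 2 ^ s i = m i}"

definition grid_orthant :: "nat \<Rightarrow> ('r \<Rightarrow> nat) \<Rightarrow> (real ^ 'r) set" where
  "grid_orthant J b = {x. \<forall>i. cell_index J x i < b i}"

lemma cell_index_measurable[measurable]:
  "(\<lambda>x. cell_index J x i) \<in> borel \<rightarrow>\<^sub>M count_space UNIV"
  unfolding cell_index_def by measurable

lemma dyadic_cell_sets[measurable]: "dyadic_cell J s m \<in> sets borel"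
  unfolding dyadic_cell_def by measurable

lemma grid_orthant_sets[measurable]: "grid_orthant J b \<in> sets borel"
  unfolding grid_orthant_def by measurable

text \<open>Expanding the product of the coordinatewise binary splittings gives one rectangle for
  each vector of scales. The truncated \<open>- 1\<close> is harmless: a quotient \<open>0\<close>
  is even, so its coefficient vanishes.\<close>

lemma indicator_grid_orthant:
  fixes b :: "'r::finite \<Rightarrow> nat"
  assumes "\<And>i. b i < 2 ^ S"
  shows "(indicator (grid_orthant J b) x :: real) =
    (\<Sum>s\<in>UNIV \<rightarrow>\<^sub>E {..<S}. (\<Prod>i\<in>UNIV. of_bool (odd (b i div 2 ^ s i))) *
       indicator (dyadic_cell J s (\<lambda>i. b i div 2 ^ s i - 1)) x)"
proof -
  have "(indicator (grid_orthant J b) x :: real) = (\<Prod>i\<in>UNIV. of_bool (cell_index J x i < b i))"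
    by (auto simp: grid_orthant_def indicator_def)
  also have "\<dots> = (\<Prod>i\<in>UNIV. \<Sum>s<S. of_bool (odd (b i div 2 ^ s)) *
      of_bool (cell_index J x i div 2 ^ s = b i div 2 ^ s - 1))"
    by (intro prod.cong refl less_dyadic_sum assms)
  also have "\<dots> = (\<Sum>s\<in>UNIV \<rightarrow>\<^sub>E {..<S}. \<Prod>i\<in>UNIV. of_bool (odd (b i div 2 ^ s i)) *
      of_bool (cell_index J x i div 2 ^ s i = b i div 2 ^ s i - 1))"
    by (rule prod_sum_PiE) auto
  also have "\<dots> = (\<Sum>s\<in>UNIV \<rightarrow>\<^sub>E {..<S}. (\<Prod>i\<in>UNIV. of_bool (odd (b i div 2 ^ s i))) *
       indicator (dyadic_cell J s (\<lambda>i. b i div 2 ^ s i - 1)) x)"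
    unfolding prod.distrib
    by (intro sum.cong refl arg_cong2[where f = "(*)"]) (auto simp: dyadic_cell_def indicator_def)
  finally show ?thesis .
qed

section \<open>Volumes of cells and slabs inside the cube\<close>

lemma emeasure_lborel_cbox_cart_le:
  fixes l :: "real ^ 'r" and w :: "'r \<Rightarrow> real"
  assumes "A \<subseteq> cbox l (\<chi> i. l $ i + w i)" "\<And>i. 0 \<le> w i"
  shows "emeasure lborel A \<le> ennreal (\<Prod>i\<in>UNIV. w i)"
proof -
  have ne: "cbox l (\<chi> i. l $ i + w i) \<noteq> {}"
    using assms(2) by (auto simp: interval_ne_empty_cart)
  have "emeasure lborel A \<le> emeasure lborel (cbox l (\<chi> i. l $ i + w i))"
    by (rule emeasure_mono[OF assms(1)]) simp
  also have "\<dots> = ennreal (measure lborel (cbox l (\<chi> i. l $ i + w i)))"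
    by (rule emeasure_eq_ennreal_measure) (use emeasure_lborel_cbox_finite in \<open>auto simp: less_top\<close>)
  also have "measure lborel (cbox l (\<chi> i. l $ i + w i)) = (\<Prod>i\<in>UNIV. w i)"
    using content_cbox_cart[OF ne] by simp
  finally show ?thesis .
qed

lemma cell_index_div_bounds:
  assumes "x \<in> unit_cube" "cell_index J x i div 2 ^ s = m"
  shows "real m * 2 ^ s / 2 ^ J \<le> x $ i" "x $ i \<le> real m * 2 ^ s / 2 ^ J + 2 ^ s / 2 ^ J"
proof -
  define c where "c = cell_index J x i"
  \<comment> \<open>Nonnegative coordinates keep \<open>nat\<close> from truncating the
    floor.\<close>
  have "0 \<le> x $ i" using assms(1) by (simp add: unit_cube_def)
  then have c: "real c \<le> 2 ^ J * x $ i" "2 ^ J * x $ i < real c + 1"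
    unfolding c_def cell_index_def
    by (simp_all add: of_nat_nat)
  have m: "m * 2 ^ s \<le> c" "c + 1 \<le> m * 2 ^ s + 2 ^ s"
    using div_times_less_eq_dividend[of c "2 ^ s"] dividend_less_div_times[of "2 ^ s" c] assms(2)
    by (auto simp: c_def)
  have "real m * 2 ^ s \<le> real c" "real c + 1 \<le> real m * 2 ^ s + 2 ^ s"
    using m[THEN of_nat_mono[where 'a = real]] by simp_all
  then have "real m * 2 ^ s \<le> 2 ^ J * x $ i" "2 ^ J * x $ i \<le> real m * 2 ^ s + 2 ^ s"
    using c by linarith+
  then show "real m * 2 ^ s / 2 ^ J \<le> x $ i" "x $ i \<le> real m * 2 ^ s / 2 ^ J + 2 ^ s / 2 ^ J"
    by (simp_all add: field_simps flip: add_divide_distrib)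
qed

lemma emeasure_dyadic_cell_le:
  fixes s :: "'r::finite \<Rightarrow> nat"
  shows "emeasure lborel (dyadic_cell J s m \<inter> unit_cube) \<le> ennreal (\<Prod>i\<in>UNIV. 2 ^ s i / 2 ^ J)"
  by (rule emeasure_lborel_cbox_cart_le[where l = "\<chi> i. real (m i) * 2 ^ s i / 2 ^ J"])
     (auto simp: dyadic_cell_def mem_box_cart intro!: cell_index_div_bounds)

text \<open>Controls the mass gained when a threshold is rounded to the grid; every coordinate other
  than \<open>i\<close> ranges over the full unit interval.\<close>

lemma emeasure_slab_le:
  fixes i :: "'r::finite"
  shows "emeasure lborel ({x. cell_index J x i = c} \<inter> unit_cube) \<le> ennreal (1 / 2 ^ J)"
proof -
  have "emeasure lborel ({x. cell_index J x i = c} \<inter> unit_cube)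
      \<le> ennreal (\<Prod>j\<in>UNIV. if j = i then 1 / 2 ^ J else 1)"
    by (rule emeasure_lborel_cbox_cart_le[where l = "\<chi> j. if j = i then real c / 2 ^ J else 0"])
       (use cell_index_div_bounds[where s = 0 and i = i and m = c and J = J]
         in \<open>auto simp: mem_box_cart unit_cube_def\<close>)
  then show ?thesis by simp
qed

text \<open>By distributivity the sum is a product of geometric sums, and the bound is free of
  \<open>J\<close>. It is used with ratio \<open>\<beta>\<close> to sum the deviations over the
  scales and with ratio \<open>1 / 2\<close> to sum their failure probabilities.\<close>

lemma sum_PiE_geometric_le:
  fixes c :: real
  assumes "0 \<le> c" "c < 1"
  shows "(\<Sum>s\<in>(UNIV :: 'r::finite set) \<rightarrow>\<^sub>E {..<Suc J}. \<Prod>i\<in>UNIV. c ^ (J - s i)) \<le> (1 / (1 - c)) ^ CARD('r)"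
proof -
  have "(\<Sum>s<Suc J. c ^ (J - s)) = (\<Sum>s<Suc J. c ^ s)"
    by (rule sum.reindex_bij_witness[where i = "\<lambda>s. J - s" and j = "\<lambda>s. J - s"]) auto
  also have "\<dots> \<le> 1 / (1 - c)"
    using assms by (subst sum_gp_strict) (auto simp: divide_right_mono)
  finally have "(\<Prod>i\<in>(UNIV :: 'r set). \<Sum>s<Suc J. c ^ (J - s)) \<le> (1 / (1 - c)) ^ CARD('r)"
    using assms by (auto intro!: power_mono sum_nonneg simp del: sum.lessThan_Suc)
  then show ?thesis
    by (subst (asm) prod_sum_PiE) auto
qed

section \<open>Root-n deviation of the empirical distribution function\<close>

text \<open>A single term of the exponential series. It trades an exponential tail for a power whose
  degree can be chosen.\<close>

lemma power_over_fact_le_exp: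
  fixes x :: real
  assumes "0 \<le> x"
  shows "x ^ N / fact N \<le> exp x"
proof -
  have "(\<Sum>k\<in>{N}. x ^ k /\<^sub>R fact k) \<le> (\<Sum>k. x ^ k /\<^sub>R fact k)"
    using assms by (intro sum_le_suminf summable_exp_generic) auto
  then show ?thesis by (simp add: exp_def field_simps)
qed

text \<open>In the application \<open>w ^ (4 * r)\<close> is the volume bound of the cell, and the
  cell is allowed a deviation proportional to \<open>w\<close>. The condition
  \<open>1 \<le> w^2 * sqrt n\<close> keeps the Chernoff parameter at most \<open>1\<close>; the
  degree \<open>8 * r\<close> makes the tail proportional to the square of that volume.\<close>

lemma cell_deviation:
  fixes w :: real
  assumes P: "prob_space P" "A \<in> sets P" and r: "0 < r"
    and w: "0 < w" "w \<le> 1" "1 \<le> w\<^sup>2 * sqrt (real n)"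
    and q: "measure P A \<le> K * w ^ (4 * r)" and "0 \<le> K" and L: "0 < L"
  shows "emeasure (PiM {..<n} (\<lambda>_. P)) {x \<in> space (PiM {..<n} (\<lambda>_. P)).
      L * sqrt (real n) * w < \<bar>\<Sum>i<n. indicator A (x i) - measure P A\<bar>}
    \<le> ennreal (2 * exp K * fact (8 * r) * (w / L) ^ (8 * r))"
proof -
  have n: "0 < real n" using w(3) by (cases "n = 0") auto
  \<comment> \<open>This makes the quadratic term of the exponent at most \<open>K\<close> and the linear one \<open>- L / w\<close>.\<close>
  define s where "s = 1 / (w\<^sup>2 * sqrt (real n))"
  have s: "0 \<le> s" "s \<le> 1" using w n by (simp_all add: s_def)
  have "w ^ (4 * r) \<le> w ^ 4"
    using w r by (intro power_decreasing) auto
  then have "measure P A \<le> K * w ^ 4"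
    using q \<open>0 \<le> K\<close> by (meson mult_left_mono order_trans)
  moreover have "real n * (s\<^sup>2 * measure P A) = measure P A / w ^ 4"
    using w n by (simp add: s_def power_divide power_mult_distrib flip: power_mult)
  ultimately have 1: "real n * (s\<^sup>2 * measure P A) \<le> K"
    using w by (simp add: divide_le_eq)
  have 2: "s * (L * sqrt (real n) * w) = L / w"
    using w n by (simp add: s_def power2_eq_square)
  have "(L / w) ^ (8 * r) / fact (8 * r) \<le> exp (L / w)"
    by (rule power_over_fact_le_exp) (use w L in auto)
  then have 3: "exp (- (L / w)) \<le> fact (8 * r) * (w / L) ^ (8 * r)"
    using w L by (simp add: exp_minus power_divide field_simps)
  have "2 * exp (real n * (s\<^sup>2 * measure P A) - s * (L * sqrt (real n) * w)) \<le> 2 * exp (K + - (L / w))"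
    using 1 2 by simp
  also have "\<dots> = 2 * exp K * exp (- (L / w))" by (simp only: exp_add)
  also have "\<dots> \<le> 2 * exp K * (fact (8 * r) * (w / L) ^ (8 * r))"
    by (intro mult_left_mono 3) auto
  finally show ?thesis
    by (intro order_trans[OF count_deviation[OF P s]] ennreal_leI) (simp add: mult.assoc)
qed

lemma indicator_sum_card:
  "(\<Sum>i<n::nat. indicator A (x i) :: real) = real (card {i\<in>{..<n}. x i \<in> A})"
proof -
  have "real (card {i\<in>{..<n}. x i \<in> A}) = (\<Sum>i | i \<in> {..<n} \<and> x i \<in> A. 1)" by simp
  also have "\<dots> = (\<Sum>i<n. if x i \<in> A then 1 else 0)" by (rule sum.inter_filter) simp
  finally show ?thesis by (simp add: indicator_def of_bool_def)
qed

text \<open>The binary expansion of \<open>b\<close> splits the orthant into disjoint dyadic cells, at most one for each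
  vector \<open>s\<close> of scales; hence the bound \<open>e s\<close> enters only once for each \<open>s\<close>.\<close>

lemma grid_orthant_deviation:
  fixes P :: "(real ^ 'r) measure" and b :: "'r \<Rightarrow> nat"
  assumes P: "prob_space P" "sets P = sets borel" and b: "\<And>i. b i < 2 ^ Suc J"
    and dev: "\<And>s m. s \<in> UNIV \<rightarrow>\<^sub>E {..<Suc J} \<Longrightarrow> m \<in> (\<Pi>\<^sub>E i\<in>UNIV. {..<2 ^ (Suc J - s i)}) \<Longrightarrow>
      \<bar>\<Sum>i<n. indicator (dyadic_cell J s m) (x i) - measure P (dyadic_cell J s m)\<bar> \<le> e s"
  shows "\<bar>\<Sum>i<n. indicator (grid_orthant J b) (x i) - measure P (grid_orthant J b)\<bar>
    \<le> (\<Sum>s\<in>UNIV \<rightarrow>\<^sub>E {..<Suc J}. e s)"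
proof -
  interpret prob_space P by fact
  have [measurable_cong]: "sets P = sets borel" by fact
  define C where "C s = dyadic_cell J s (\<lambda>i. b i div 2 ^ s i - 1)" for s :: "'r \<Rightarrow> nat"
  define \<epsilon> :: "('r \<Rightarrow> nat) \<Rightarrow> real" where "\<epsilon> s = (\<Prod>i\<in>UNIV. of_bool (odd (b i div 2 ^ s i)))" for s
  let ?S = "(UNIV :: 'r set) \<rightarrow>\<^sub>E {..<Suc J}"
  have ind: "indicator (grid_orthant J b) y = (\<Sum>s\<in>?S. \<epsilon> s * indicator (C s) y)" for y
    unfolding C_def \<epsilon>_def by (rule indicator_grid_orthant[OF b])
  have C: "C s \<in> sets P" for s by (simp add: C_def)
  have "measure P (grid_orthant J b) = (\<integral>y. indicator (grid_orthant J b) y \<partial>P)"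
    by simp
  also have "\<dots> = (\<Sum>s\<in>?S. \<epsilon> s * measure P (C s))"
    unfolding ind using C
    by (subst Bochner_Integration.integral_sum)
       (auto intro!: integrable_real_indicator simp: less_top[symmetric])
  finally have "(\<Sum>i<n. indicator (grid_orthant J b) (x i) - measure P (grid_orthant J b))
      = (\<Sum>i<n. \<Sum>s\<in>?S. \<epsilon> s * (indicator (C s) (x i) - measure P (C s)))"
    by (simp add: ind sum_subtractf right_diff_distrib)
  also have "\<dots> = (\<Sum>s\<in>?S. \<epsilon> s * (\<Sum>i<n. indicator (C s) (x i) - measure P (C s)))"
    unfolding sum_distrib_left by (rule sum.swap)
  also have "\<bar>\<dots>\<bar> \<le> (\<Sum>s\<in>?S. \<bar>\<epsilon> s * (\<Sum>i<n. indicator (C s) (x i) - measure P (C s))\<bar>)"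
    by (rule sum_abs)
  also have "\<dots> \<le> (\<Sum>s\<in>?S. e s)"
  proof (rule sum_mono)
    fix s assume s: "s \<in> ?S"
    \<comment> \<open>Places the cell of scales \<open>s\<close> in the finite family on which
      \<open>dev\<close> is assumed.\<close>
    have "b i div 2 ^ s i - 1 < 2 ^ (Suc J - s i)" for i
    proof -
      have "s i < Suc J" using s by auto
      then have "2 ^ Suc J = 2 ^ (Suc J - s i) * (2::nat) ^ s i"
        by (simp flip: power_add)
      then have "b i div 2 ^ s i < 2 ^ (Suc J - s i)"
        using b[of i] by (simp add: less_mult_imp_div_less)
      then show ?thesis by simp
    qed
    then have "\<bar>\<Sum>i<n. indicator (C s) (x i) - measure P (C s)\<bar> \<le> e s"
      unfolding C_def by (intro dev s) auto
    moreover have "0 \<le> \<epsilon> s" "\<epsilon> s \<le> 1"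
      by (auto simp: \<epsilon>_def intro!: prod_nonneg prod_le_1)
    ultimately show "\<bar>\<epsilon> s * (\<Sum>i<n. indicator (C s) (x i) - measure P (C s))\<bar> \<le> e s"
      using mult_mono[of "\<epsilon> s" 1 "\<bar>\<Sum>i<n. indicator (C s) (x i) - measure P (C s)\<bar>" "e s"]
      by (simp add: abs_mult)
  qed
  finally show ?thesis .
qed

text \<open>Rounding \<open>t\<close> down and up to the grid brackets its orthant between
  \<open>lo\<close> and \<open>hi\<close>. These differ by at most one slab per coordinate, and
  counts and probabilities are both monotone, so deviation bounds on grid orthants suffice.\<close>

lemma ks_dist_le_grid_deviation:
  fixes P :: "(real ^ 'r) measure"
  assumes P: "prob_space P" "sets P = sets borel"
    and dom: "\<And>A. A \<in> sets borel \<Longrightarrow> emeasure P A \<le> ennreal K * emeasure lborel (A \<inter> unit_cube)"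
    and K: "0 \<le> K" and n: "0 < n" and J: "0 < J"
    and dev: "\<And>b. (\<And>i. b i < 2 ^ Suc J) \<Longrightarrow>
      \<bar>\<Sum>i<n. indicator (grid_orthant J b) (x i) - measure P (grid_orthant J b)\<bar> \<le> e"
  shows "ks_dist (cdf_of P) (ecdf n x) \<le> e / real n + real CARD('r) * K / 2 ^ J"
proof (rule ks_dist_le)
  interpret prob_space P by fact
  have [measurable_cong]: "sets P = sets borel" by fact
  fix t :: "real ^ 'r" assume t: "t \<in> unit_cube"
  define b where "b i = cell_index J t i" for i
  define lo where "lo = grid_orthant J b"
  define hi where "hi = grid_orthant J (\<lambda>i. Suc (b i))"
  define mid where "mid = {x. \<forall>j. x $ j \<le> t $ j}"
  define slab where "slab i = {x. cell_index J x i = b i}" for i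
  have [measurable]: "slab i \<in> sets P" for i unfolding slab_def by measurable
  have [measurable]: "lo \<in> sets P" "hi \<in> sets P" "mid \<in> sets P"
    unfolding lo_def hi_def mid_def by measurable
  have b1: "b i \<le> 2 ^ J" for i
  proof -
    have "2 ^ J * t $ i \<le> 2 ^ J" using t by (simp add: unit_cube_def)
    then have "\<lfloor>2 ^ J * t $ i\<rfloor> \<le> \<lfloor>real_of_int (2 ^ J)\<rfloor>" by (intro floor_mono) simp
    then have "\<lfloor>2 ^ J * t $ i\<rfloor> \<le> 2 ^ J" by (simp only: floor_of_int)
    then show ?thesis by (simp add: b_def cell_index_def nat_le_iff)
  qed
  \<comment> \<open>A coordinate \<open>t $ i = 1\<close> gives \<open>b i = 2 ^ J\<close>, so
    \<open>hi\<close> uses the index \<open>2 ^ J + 1\<close>. For this to stay below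
    \<open>2 ^ Suc J\<close>, \<open>J\<close> must be positive.\<close>
  have b2: "(2::nat) \<le> 2 ^ J" using J by (cases J) auto
  have b: "b i < 2 ^ Suc J" "Suc (b i) < 2 ^ Suc J" for i
  proof -
    show "b i < 2 ^ Suc J" "Suc (b i) < 2 ^ Suc J"
      unfolding power_Suc using b1[of i] b2 by linarith+
  qed
  have sub1: "lo \<subseteq> mid"
  proof
    fix y assume y: "y \<in> lo"
    have "y $ i \<le> t $ i" for i
    proof (rule ccontr)
      assume "\<not> y $ i \<le> t $ i"
      then have "cell_index J t i \<le> cell_index J y i"
        by (auto simp: cell_index_def intro!: nat_mono floor_mono)
      then show False using y by (auto simp: lo_def grid_orthant_def b_def not_less[symmetric])
    qed
    then show "y \<in> mid" by (simp add: mid_def)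
  qed
  have sub2: "mid \<subseteq> hi"
    by (auto simp: mid_def hi_def grid_orthant_def b_def cell_index_def less_Suc_eq_le
          intro!: nat_mono floor_mono)
  have sub3: "hi \<subseteq> lo \<union> (\<Union>i. slab i)"
    by (auto simp: hi_def lo_def grid_orthant_def slab_def less_Suc_eq)
  have slab: "prob (slab i) \<le> K / 2 ^ J" for i
  proof -
    have "emeasure P (slab i) \<le> ennreal K * ennreal (1 / 2 ^ J)"
      unfolding slab_def
      by (intro order_trans[OF dom] mult_left_mono emeasure_slab_le) (auto simp flip: slab_def P(2))
    then show ?thesis using K by (simp add: emeasure_eq_measure flip: ennreal_mult)
  qed
  have "prob hi \<le> prob (lo \<union> (\<Union>i. slab i))"
    by (rule finite_measure_mono[OF sub3]) measurable
  also have "\<dots> \<le> prob lo + prob (\<Union>i. slab i)"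
    by (rule measure_Un_le) measurable
  also have "prob (\<Union>i. slab i) \<le> (\<Sum>i\<in>UNIV. prob (slab i))"
    by (rule measure_UNION_le) auto
  also have "\<dots> \<le> real CARD('r) * (K / 2 ^ J)"
    by (rule sum_bounded_above[where A = UNIV, simplified]) (rule slab)
  finally have gap: "prob hi \<le> prob lo + real CARD('r) * K / 2 ^ J" by simp
  have mono: "prob lo \<le> prob mid" "prob mid \<le> prob hi"
    by (intro finite_measure_mono sub1 sub2; measurable)+
  define N :: "(real ^ 'r) set \<Rightarrow> real" where "N A = (\<Sum>i<n. indicator A (x i))" for A
  have Nmono: "N lo \<le> N mid" "N mid \<le> N hi"
    unfolding N_def using sub1 sub2 by (auto intro!: sum_mono indicator_leI)
  have "\<bar>N lo - real n * prob lo\<bar> \<le> e" "\<bar>N hi - real n * prob hi\<bar> \<le> e"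
    using dev[of b] dev[of "\<lambda>i. Suc (b i)"] b by (simp_all add: N_def lo_def hi_def sum_subtractf)
  then have "\<bar>N lo / real n - prob lo\<bar> \<le> e / real n" "\<bar>N hi / real n - prob hi\<bar> \<le> e / real n"
    using n by (simp_all add: abs_le_iff field_simps)
  moreover have "N lo / real n \<le> N mid / real n" "N mid / real n \<le> N hi / real n"
    using Nmono by (simp_all add: divide_right_mono)
  moreover have "ecdf n x t = N mid / real n" "cdf_of P t = prob mid"
    by (simp_all add: ecdf_def cdf_of_def N_def mid_def indicator_sum_card)
  ultimately show "\<bar>cdf_of P t - ecdf n x t\<bar> \<le> e / real n + real CARD('r) * K / 2 ^ J"
    using gap mono by linarith
qed

text \<open>A union bound over the dyadic cells of all scales, followed on the complement by the
  rounding estimate. The exceptional event is a measurable set built from finitely many counts, so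
  the supremum over \<open>t\<close> is only treated pointwise in the sample.\<close>

lemma ks_dist_empirical_tail:
  fixes P :: "(real ^ 'r) measure" and \<beta> :: real
  defines "r \<equiv> CARD('r)" and "\<beta> \<equiv> root (4 * CARD('r)) (1 / 2)"
  assumes P: "prob_space P" "sets P = sets borel"
    and dom: "\<And>A. A \<in> sets borel \<Longrightarrow> emeasure P A \<le> ennreal K * emeasure lborel (A \<inter> unit_cube)"
    and K: "0 \<le> K" and L: "0 < L" and n: "4 \<le> n"
  shows "\<exists>Bad\<in>sets (PiM {..<n} (\<lambda>_. P)).
    emeasure (PiM {..<n} (\<lambda>_. P)) Bad \<le> ennreal (2 * 4 ^ r * exp K * fact (8 * r) / L ^ (8 * r)) \<and>
    (\<forall>x\<in>space (PiM {..<n} (\<lambda>_. P)) - Bad.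
      ks_dist (cdf_of P) (ecdf n x) \<le> (L * (1 / (1 - \<beta>)) ^ r + 2 * real r * K) / sqrt n)"
proof -
  interpret prob_space P by fact
  have [measurable_cong]: "sets P = sets borel" by fact
  have r: "0 < r" by (simp add: r_def)
  have \<beta>: "0 < \<beta>" "\<beta> < 1" and \<beta>r: "\<beta> ^ (4 * r) = 1 / 2"
    using r by (auto simp: \<beta>_def r_def real_root_lt_1_iff)
  \<comment> \<open>The mesh \<open>1 / 2 ^ J\<close> then lies between \<open>1 / sqrt n\<close>
    and \<open>2 / sqrt n\<close>, so the rounding error has the same order as the random
    error.\<close>
  obtain J where J: "4 ^ J \<le> n" "n < 4 ^ (J + 1)"
    using ex_power_ivl1[of 4 n] n by auto
  have J0: "0 < J" using J(2) n by (cases J) auto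
  have four: "sqrt (4 ^ j) = 2 ^ j" for j :: nat
    by (simp add: real_sqrt_power)
  have "real (4 ^ J) \<le> real n" "real n \<le> real (4 ^ (J + 1))"
    using J by (simp_all only: of_nat_le_iff less_imp_le)
  then have "sqrt (4 ^ J) \<le> sqrt n" "sqrt n \<le> sqrt (4 ^ (J + 1))"
    by (simp_all only: real_sqrt_le_iff of_nat_power of_nat_numeral)
  then have sqn: "2 ^ J \<le> sqrt n" "sqrt n \<le> 2 * 2 ^ J"
    unfolding four by simp_all
  let ?N = "PiM {..<n} (\<lambda>_. P)"
  let ?S = "(UNIV :: 'r set) \<rightarrow>\<^sub>E {..<Suc J}"
  let ?M = "\<lambda>s :: 'r \<Rightarrow> nat. \<Pi>\<^sub>E i\<in>UNIV. {..<(2::nat) ^ (Suc J - s i)}"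
  \<comment> \<open>A cell of scales \<open>s\<close> has volume \<open>w s ^ (4 * r)\<close>. The weights are summable over \<open>s\<close>, while the tail bound
    \<open>w s ^ (8 * r)\<close> still beats the number \<open>2 ^ r / w s ^ (4 * r)\<close> of cells of these scales.\<close>
  define w where "w s = (\<Prod>i\<in>UNIV. \<beta> ^ (J - s i))" for s :: "'r \<Rightarrow> nat"
  define T where "T s m x = (\<Sum>i<n. indicator (dyadic_cell J s m) (x i) - prob (dyadic_cell J s m))"
    for s m :: "'r \<Rightarrow> nat" and x :: "nat \<Rightarrow> real ^ 'r"
  define Bad where "Bad = (\<Union>s\<in>?S. \<Union>m\<in>?M s. {x \<in> space ?N. L * sqrt n * w s < \<bar>T s m x\<bar>})"
  have [measurable]: "T s m \<in> borel_measurable ?N" for s m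
    unfolding T_def by measurable
  have fin: "finite ?S" "finite (?M s)" for s
    by (auto intro!: finite_PiE)
  have w: "0 < w s" "w s \<le> 1" for s
    using \<beta> by (auto simp: w_def intro!: prod_pos prod_le_1 power_le_one)
  have w4: "w s ^ (4 * r) = (\<Prod>i\<in>UNIV. (1 / 2) ^ (J - s i))" for s
    unfolding w_def \<beta>r[symmetric] by (simp only: prod_power_distrib power_mult[symmetric] mult.commute)
  \<comment> \<open>The weight is least when all scales are finest. There its square is
    \<open>\<beta> ^ (2 * J * r)\<close>, at least
    \<open>\<beta> ^ (4 * r * J) = (1 / 2) ^ J\<close>, while \<open>sqrt n\<close> is at least
    \<open>2 ^ J\<close>.\<close>
  have wn: "1 \<le> (w s)\<^sup>2 * sqrt n" for s
  proof -
    have "(\<Prod>i\<in>(UNIV :: 'r set). \<beta> ^ J) \<le> w s"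
      unfolding w_def using \<beta> by (intro prod_mono conjI power_decreasing) auto
    then have "\<beta> ^ (J * r) \<le> w s"
      by (simp add: r_def power_mult)
    then have "(\<beta> ^ (J * r))\<^sup>2 \<le> (w s)\<^sup>2"
      using \<beta> by (intro power_mono) auto
    moreover have "(1 / 2) ^ J \<le> (\<beta> ^ (J * r))\<^sup>2"
    proof -
      have "(1 / 2) ^ J = \<beta> ^ (4 * r * J)" by (simp only: power_mult[of \<beta> "4 * r" J] \<beta>r)
      also have "\<dots> \<le> \<beta> ^ (J * r * 2)" using \<beta> by (intro power_decreasing) auto
      finally show ?thesis by (simp add: power_mult)
    qed
    ultimately have "(1 / 2) ^ J * 2 ^ J \<le> (w s)\<^sup>2 * sqrt n"
      using sqn by (intro mult_mono) auto
    then show ?thesis by (simp flip: power_mult_distrib)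
  qed
  have q: "prob (dyadic_cell J s m) \<le> K * w s ^ (4 * r)" if "s \<in> ?S" for s m
  proof -
    have le: "s i \<le> J" for i using that by (auto simp: less_Suc_eq_le)
    have "emeasure P (dyadic_cell J s m) \<le> ennreal K * ennreal (\<Prod>i\<in>UNIV. 2 ^ s i / 2 ^ J)"
      by (intro order_trans[OF dom] mult_left_mono emeasure_dyadic_cell_le) auto
    also have "(\<Prod>i\<in>UNIV. 2 ^ s i / 2 ^ J) = w s ^ (4 * r)"
      unfolding w4 using le by (intro prod.cong) (auto simp: power_diff power_one_over)
    finally show ?thesis
      using K w[of s] by (simp add: emeasure_eq_measure flip: ennreal_mult)
  qed
  define c where "c = 2 * exp K * fact (8 * r) / L ^ (8 * r)"
  have c: "0 \<le> c" using L by (simp add: c_def)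
  have "emeasure ?N Bad \<le> (\<Sum>s\<in>?S. emeasure ?N (\<Union>m\<in>?M s. {x \<in> space ?N. L * sqrt n * w s < \<bar>T s m x\<bar>}))"
    unfolding Bad_def
    by (intro emeasure_subadditive_finite fin) (auto intro!: sets.finite_UN fin)
  also have "\<dots> \<le> (\<Sum>s\<in>?S. \<Sum>m\<in>?M s. emeasure ?N {x \<in> space ?N. L * sqrt n * w s < \<bar>T s m x\<bar>})"
    by (intro sum_mono emeasure_subadditive_finite fin) auto
  also have "\<dots> \<le> (\<Sum>s\<in>?S. \<Sum>m\<in>?M s. ennreal (2 * exp K * fact (8 * r) * (w s / L) ^ (8 * r)))"
    unfolding T_def
    by (intro sum_mono cell_deviation P r w wn q K L) (auto simp: P(2))
  also have "\<dots> = (\<Sum>s\<in>?S. ennreal (c * 2 ^ r * w s ^ (4 * r)))"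
  proof (rule sum.cong[OF refl])
    fix s assume "s \<in> ?S"
    then have le: "s i \<le> J" for i by (auto simp: less_Suc_eq_le)
    have "real (card (?M s)) * w s ^ (4 * r) = 2 ^ r"
    proof -
      have "real (card (?M s)) = (\<Prod>i\<in>UNIV. 2 * 2 ^ (J - s i))"
        using le by (subst card_PiE) (auto simp: Suc_diff_le)
      then have "real (card (?M s)) * w s ^ (4 * r) = (\<Prod>i\<in>(UNIV :: 'r set). 2)"
        unfolding w4 by (simp only: prod.distrib[symmetric]) (simp add: power_one_over)
      then show ?thesis by (simp add: r_def)
    qed
    moreover have "w s ^ (8 * r) = w s ^ (4 * r) * w s ^ (4 * r)"
      by (simp flip: power_add)
    ultimately have card: "real (card (?M s)) * w s ^ (8 * r) = 2 ^ r * w s ^ (4 * r)"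
      by simp
    have "(\<Sum>m\<in>?M s. ennreal (2 * exp K * fact (8 * r) * (w s / L) ^ (8 * r)))
        = ennreal (real (card (?M s)) * (c * w s ^ (8 * r)))"
      by (simp add: c_def power_divide ennreal_of_nat_eq_real_of_nat flip: ennreal_mult')
    also have "\<dots> = ennreal (c * 2 ^ r * w s ^ (4 * r))"
      using card by (simp add: mult_ac)
    finally show "(\<Sum>m\<in>?M s. ennreal (2 * exp K * fact (8 * r) * (w s / L) ^ (8 * r))) = \<dots>" .
  qed
  also have "\<dots> = ennreal (c * 2 ^ r * (\<Sum>s\<in>?S. w s ^ (4 * r)))"
    using c w by (subst sum_ennreal) (auto simp: sum_distrib_left less_imp_le)
  also have "\<dots> \<le> ennreal (c * 2 ^ r * 2 ^ r)"
  proof -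
    \<comment> \<open>The earlier factor \<open>2 ^ r\<close> came from counting cells, this one
      comes from summing over the scales.\<close>
    have "(\<Sum>s\<in>?S. w s ^ (4 * r)) \<le> 2 ^ r"
      unfolding w4 using sum_PiE_geometric_le[of "1 / 2" J, where 'r = 'r] by (simp add: r_def)
    then show ?thesis using c by (intro ennreal_leI mult_left_mono) auto
  qed
  also have "c * 2 ^ r * 2 ^ r = 2 * 4 ^ r * exp K * fact (8 * r) / L ^ (8 * r)"
    by (simp add: c_def mult.assoc flip: power_mult_distrib)
  finally have 1: "emeasure ?N Bad \<le> ennreal (2 * 4 ^ r * exp K * fact (8 * r) / L ^ (8 * r))" .
  have "ks_dist (cdf_of P) (ecdf n x) \<le> (L * (1 / (1 - \<beta>)) ^ r + 2 * real r * K) / sqrt n"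
    if "x \<in> space ?N - Bad" for x
  proof -
    have "ks_dist (cdf_of P) (ecdf n x)
        \<le> (\<Sum>s\<in>?S. L * sqrt n * w s) / n + real CARD('r) * K / 2 ^ J"
    proof (rule ks_dist_le_grid_deviation[OF P dom K _ J0])
      fix b :: "'r \<Rightarrow> nat" assume "\<And>i. b i < 2 ^ Suc J"
      then show "\<bar>\<Sum>i<n. indicator (grid_orthant J b) (x i) - prob (grid_orthant J b)\<bar>
          \<le> (\<Sum>s\<in>?S. L * sqrt n * w s)"
        by (rule grid_orthant_deviation[OF P])
           (use that in \<open>auto simp: Bad_def T_def not_less\<close>)
    qed (use n in auto)
    also have "(\<Sum>s\<in>?S. L * sqrt n * w s) / n = L * (\<Sum>s\<in>?S. w s) / sqrt n"
    proof -
      have "(\<Sum>s\<in>?S. L * sqrt n * w s) / n = (L * (\<Sum>s\<in>?S. w s)) * (sqrt n / n)"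
        unfolding sum_distrib_left[symmetric] by simp
      also have "\<dots> = L * (\<Sum>s\<in>?S. w s) / sqrt n"
        unfolding sqrt_divide_self_eq[OF of_nat_0_le_iff] by (rule divide_inverse[symmetric])
      finally show ?thesis .
    qed
    also have "\<dots> \<le> L * (1 / (1 - \<beta>)) ^ r / sqrt n"
    proof -
      have "(\<Sum>s\<in>?S. w s) \<le> (1 / (1 - \<beta>)) ^ r"
        unfolding w_def r_def by (rule sum_PiE_geometric_le) (use \<beta> in auto)
      then show ?thesis using L by (intro divide_right_mono mult_left_mono) auto
    qed
    also have "real CARD('r) * K / 2 ^ J \<le> 2 * real r * K / sqrt n"
    proof -
      have "real r * K * sqrt n \<le> real r * K * (2 * 2 ^ J)"
        using K sqn(2) by (intro mult_left_mono) auto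
      then show ?thesis using n by (simp add: r_def divide_simps mult_ac)
    qed
    finally show ?thesis by (simp add: add_divide_distrib)
  qed
  moreover have "Bad \<in> sets ?N"
    unfolding Bad_def by (intro sets.finite_UN fin) auto
  ultimately show ?thesis by (intro bexI[of _ Bad] conjI ballI 1)
qed

text \<open>One constant serves all positive sample sizes because the bound is applied twice, to the
  data of size \<open>n\<close> and to a sample of the output size \<open>k n\<close>.\<close>

lemma ks_dist_empirical_O:
  fixes P :: "(real ^ 'r) measure"
  assumes P: "prob_space P" "sets P = sets borel"
    and dom: "\<And>A. A \<in> sets borel \<Longrightarrow> emeasure P A \<le> ennreal K * emeasure lborel (A \<inter> unit_cube)"
    and K: "0 \<le> K" and \<eta>: "0 < \<eta>"
  shows "\<exists>C>0. \<forall>n>0. \<exists>Bad\<in>sets (PiM {..<n} (\<lambda>_. P)). emeasure (PiM {..<n} (\<lambda>_. P)) Bad \<le> ennreal \<eta> \<and>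
    (\<forall>x\<in>space (PiM {..<n} (\<lambda>_. P)) - Bad. ks_dist (cdf_of P) (ecdf n x) \<le> C / sqrt n)"
proof -
  interpret prob_space P by fact
  define r where "r = CARD('r)"
  define \<beta> :: real where "\<beta> = root (4 * r) (1 / 2)"
  define D where "D = 2 * 4 ^ r * exp K * fact (8 * r)"
  \<comment> \<open>With \<open>L \<ge> 1\<close> and \<open>8 * r \<ge> 1\<close>, the tail
    \<open>D / L ^ (8 * r)\<close> is at most \<open>D / L\<close>, hence at most
    \<open>\<eta>\<close>.\<close>
  define L where "L = max 1 (D / \<eta>)"
  have r: "0 < r" by (simp add: r_def)
  have D: "0 < D" by (simp add: D_def)
  have L: "1 \<le> L" "D / \<eta> \<le> L" by (simp_all add: L_def)
  have \<beta>: "\<beta> < 1" using r by (simp add: \<beta>_def real_root_lt_1_iff)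
  have "L ^ 1 \<le> L ^ (8 * r)" using L r by (intro power_increasing) auto
  then have "D / \<eta> \<le> L ^ (8 * r)" using L by simp
  then have tail: "D / L ^ (8 * r) \<le> \<eta>" using L \<eta> by (simp add: field_simps)
  \<comment> \<open>The \<open>2\<close> settles \<open>n < 4\<close>: there
    \<open>C / sqrt n\<close> is at least \<open>1\<close>, and the distance never exceeds
    \<open>1\<close>.\<close>
  define C where "C = max 2 (L * (1 / (1 - \<beta>)) ^ r + 2 * real r * K)"
  have "\<exists>Bad\<in>sets (PiM {..<n} (\<lambda>_. P)). emeasure (PiM {..<n} (\<lambda>_. P)) Bad \<le> ennreal \<eta> \<and>
    (\<forall>x\<in>space (PiM {..<n} (\<lambda>_. P)) - Bad. ks_dist (cdf_of P) (ecdf n x) \<le> C / sqrt n)" if "0 < n" for n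
  proof (cases "4 \<le> n")
    case True
    have "0 < L" using L by simp
    from ks_dist_empirical_tail[OF P dom K this True, folded r_def, folded \<beta>_def D_def]
    obtain Bad where Bad: "Bad \<in> sets (PiM {..<n} (\<lambda>_. P))"
      "emeasure (PiM {..<n} (\<lambda>_. P)) Bad \<le> ennreal (D / L ^ (8 * r))"
      "\<And>x. x \<in> space (PiM {..<n} (\<lambda>_. P)) - Bad \<Longrightarrow>
        ks_dist (cdf_of P) (ecdf n x) \<le> (L * (1 / (1 - \<beta>)) ^ r + 2 * real r * K) / sqrt n"
      by auto
    have "(L * (1 / (1 - \<beta>)) ^ r + 2 * real r * K) / sqrt n \<le> C / sqrt n"
      by (intro divide_right_mono) (auto simp: C_def)
    then show ?thesis
      using Bad tail by (intro bexI[of _ Bad]) (auto intro: order_trans ennreal_leI)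
  next
    case False
    have "sqrt n \<le> sqrt 4" using False by (intro real_sqrt_le_mono) simp
    then have "1 \<le> C / sqrt n" using that by (simp add: C_def)
    moreover have "ks_dist (cdf_of P) (ecdf n x) \<le> 1" for x
    proof (rule ks_dist_le)
      fix t
      have "0 \<le> cdf_of P t" "cdf_of P t \<le> 1" by (auto simp: cdf_of_def)
      then show "\<bar>cdf_of P t - ecdf n x t\<bar> \<le> 1" using ecdf_bounds[of n x t] by linarith
    qed
    ultimately show ?thesis by (intro bexI[of _ "{}"]) (auto intro: order_trans)
  qed
  moreover have "0 < C" by (simp add: C_def)
  ultimately show ?thesis by blast
qed

section \<open>Product densities on the unit cube\<close>

lemma unit_cube_sets[measurable]: "unit_cube \<in> sets borel"
  unfolding unit_cube_def by measurable

lemma emeasure_unit_cube: "emeasure lborel (unit_cube :: (real ^ 'r) set) = 1"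
proof -
  have eq: "(unit_cube :: (real ^ 'r) set) = cbox 0 1"
    by (auto simp: unit_cube_def mem_box_cart)
  then have "cbox (0 :: real ^ 'r) 1 \<noteq> {}" using unit_cube_nonempty by auto
  then have "measure lborel (cbox (0 :: real ^ 'r) 1) = 1"
    by (subst content_cbox_cart) auto
  then show ?thesis
    unfolding eq
    by (subst emeasure_eq_ennreal_measure) (use emeasure_lborel_cbox_finite in \<open>auto simp: less_top\<close>)
qed

lemma dbs_sets[measurable]: "dbs k \<in> sets (leb_k k)"
  unfolding dbs_def leb_k_def by (rule sets_PiM_I_finite) auto

lemma emeasure_dbs: "emeasure (leb_k k) (dbs k :: (nat \<Rightarrow> real ^ 'r) set) = 1"
proof -
  interpret product_sigma_finite "\<lambda>_::nat. lborel :: (real ^ 'r) measure" ..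
  show ?thesis
    unfolding dbs_def leb_k_def by (subst emeasure_PiM) (auto simp: emeasure_unit_cube)
qed

text \<open>A product measure is determined by its values on rectangles; there the integrand
  factorises, so its integral is a product.\<close>

lemma PiM_density_eq:
  fixes f :: "'a \<Rightarrow> ennreal"
  assumes M: "sigma_finite_measure M" and f: "f \<in> borel_measurable M"
    and "sigma_finite_measure (density M f)" and I: "finite I"
  shows "PiM I (\<lambda>_. density M f) = density (PiM I (\<lambda>_. M)) (\<lambda>x. \<Prod>i\<in>I. f (x i))"
proof -
  interpret M: product_sigma_finite "\<lambda>_. M" using M by (simp add: product_sigma_finite_def)
  interpret D: product_sigma_finite "\<lambda>_. density M f"
    using assms(3) by (simp add: product_sigma_finite_def)
  note f[measurable]
  show ?thesis
  proof (rule D.PiM_eqI[OF I, symmetric])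
    show "sets (density (PiM I (\<lambda>_. M)) (\<lambda>x. \<Prod>i\<in>I. f (x i))) = sets (PiM I (\<lambda>_. density M f))"
      by (simp cong: sets_PiM_cong)
  next
    fix A assume A: "\<And>i. i \<in> I \<Longrightarrow> A i \<in> sets (density M f)"
    then have A': "\<And>i. i \<in> I \<Longrightarrow> A i \<in> sets M" by simp
    have "emeasure (density (PiM I (\<lambda>_. M)) (\<lambda>x. \<Prod>i\<in>I. f (x i))) (Pi\<^sub>E I A)
        = (\<integral>\<^sup>+ x. (\<Prod>i\<in>I. f (x i)) * indicator (Pi\<^sub>E I A) x \<partial>PiM I (\<lambda>_. M))"
      using I A' by (intro emeasure_density sets_PiM_I_finite) auto
    also have "\<dots> = (\<integral>\<^sup>+ x. (\<Prod>i\<in>I. f (x i) * indicator (A i) (x i)) \<partial>PiM I (\<lambda>_. M))"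
    proof (rule nn_integral_cong)
      fix x assume "x \<in> space (PiM I (\<lambda>_. M))"
      then have "indicator (Pi\<^sub>E I A) x = (\<Prod>i\<in>I. indicator (A i) (x i) :: ennreal)"
        using I by (auto simp: space_PiM PiE_iff indicator_def prod_zero_iff)
      then show "(\<Prod>i\<in>I. f (x i)) * indicator (Pi\<^sub>E I A) x = (\<Prod>i\<in>I. f (x i) * indicator (A i) (x i))"
        by (simp add: prod.distrib)
    qed
    also have "\<dots> = (\<Prod>i\<in>I. \<integral>\<^sup>+ x. f x * indicator (A i) x \<partial>M)"
      using I A' by (intro M.product_nn_integral_prod) auto
    also have "\<dots> = (\<Prod>i\<in>I. emeasure (density M f) (A i))"
      using A' by (intro prod.cong) (auto simp: emeasure_density)
    finally show "emeasure (density (PiM I (\<lambda>_. M)) (\<lambda>x. \<Prod>i\<in>I. f (x i))) (Pi\<^sub>E I A)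
      = (\<Prod>i\<in>I. emeasure (density M f) (A i))" .
  qed
qed

lemma emeasure_density_unit_cube_le:
  fixes p :: "real ^ 'r \<Rightarrow> real"
  assumes [measurable]: "p \<in> borel_measurable lborel" and p: "\<And>x. x \<in> unit_cube \<Longrightarrow> p x \<le> K"
    and A: "A \<in> sets borel"
  shows "emeasure (density lborel (\<lambda>x. ennreal (p x * indicator unit_cube x))) A
    \<le> ennreal K * emeasure lborel (A \<inter> unit_cube)"
proof -
  have "emeasure (density lborel (\<lambda>x. ennreal (p x * indicator unit_cube x))) A
      = (\<integral>\<^sup>+ x. ennreal (p x * indicator unit_cube x) * indicator A x \<partial>lborel)"
    using A by (intro emeasure_density) auto
  also have "\<dots> \<le> (\<integral>\<^sup>+ x. ennreal K * indicator (A \<inter> unit_cube) x \<partial>lborel)"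
    using p by (intro nn_integral_mono) (auto simp: indicator_def ennreal_leI)
  also have "\<dots> = ennreal K * emeasure lborel (A \<inter> unit_cube)"
    using A by (intro nn_integral_cmult_indicator) auto
  finally show ?thesis .
qed

text \<open>The product density is at most \<open>K ^ k\<close> on \<open>dbs k\<close> and zero off
  it. It is used in reverse: a set of large product probability must have volume at least of order
  \<open>1 / K ^ k\<close>.\<close>

lemma emeasure_PiM_density_unit_cube_le:
  fixes p :: "real ^ 'r \<Rightarrow> real"
  defines "P \<equiv> density lborel (\<lambda>x. ennreal (p x * indicator unit_cube x))"
  assumes [measurable]: "p \<in> borel_measurable lborel" and p: "\<And>x. x \<in> unit_cube \<Longrightarrow> p x \<le> K"
    and K: "0 \<le> K" and "prob_space P" and A: "A \<in> sets (PiM {..<k} (\<lambda>_. P))"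
  shows "emeasure (PiM {..<k} (\<lambda>_. P)) A \<le> ennreal (K ^ k) * emeasure (leb_k k) (A \<inter> dbs k)"
proof -
  interpret prob_space P by fact
  let ?f = "\<lambda>x. ennreal (p x * indicator unit_cube x)"
  have eq: "PiM {..<k} (\<lambda>_. P) = density (leb_k k) (\<lambda>z. \<Prod>i<k. ?f (z i))"
    unfolding P_def leb_k_def
    by (rule PiM_density_eq) (auto simp: P_def[symmetric] sigma_finite_measure_axioms lborel.sigma_finite_measure_axioms)
  have A': "A \<in> sets (leb_k k)" using A by (simp add: eq)
  have m: "(\<lambda>z. \<Prod>i<k. ?f (z i)) \<in> borel_measurable (leb_k k)"
    unfolding leb_k_def by measurable
  have "emeasure (PiM {..<k} (\<lambda>_. P)) A = (\<integral>\<^sup>+ z. (\<Prod>i<k. ?f (z i)) * indicator A z \<partial>leb_k k)"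
    unfolding eq by (rule emeasure_density[OF m A'])
  also have "\<dots> \<le> (\<integral>\<^sup>+ z. ennreal (K ^ k) * indicator (A \<inter> dbs k) z \<partial>leb_k k)"
  proof (rule nn_integral_mono)
    fix z assume z: "z \<in> space (leb_k k :: (nat \<Rightarrow> real ^ 'r) measure)"
    show "(\<Prod>i<k. ?f (z i)) * indicator A z \<le> ennreal (K ^ k) * indicator (A \<inter> dbs k) z"
    proof (cases "z \<in> dbs k")
      case True
      then have "(\<Prod>i<k. ?f (z i)) \<le> (\<Prod>i<k. ennreal K)"
        using p by (intro prod_mono_ennreal) (auto simp: dbs_def intro!: ennreal_leI dest: PiE_mem)
      also have "\<dots> = ennreal (K ^ k)" using K by (simp add: ennreal_power)
      finally show ?thesis using True by (auto simp: indicator_def)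
    next
      case False
      then obtain i where "i < k" "z i \<notin> unit_cube"
        using z by (auto simp: dbs_def leb_k_def space_PiM PiE_iff)
      then have "(\<Prod>i<k. ?f (z i)) = 0" by (intro prod_zero) (auto intro!: bexI[of _ i])
      then show ?thesis by (simp only: mult_zero_left zero_le)
    qed
  qed
  also have "\<dots> = ennreal (K ^ k) * emeasure (leb_k k) (A \<inter> dbs k)"
    using A' by (intro nn_integral_cmult_indicator) auto
  finally show ?thesis .
qed

section \<open>The exponential mechanism\<close>

text \<open>The degenerate quotients \<open>0 / 0\<close> and \<open>x / top\<close> are both
  \<open>0\<close> in \<open>ennreal\<close>, so the bound covers every denominator.\<close>

lemma ennreal_divide_le_one:
  fixes a b :: ennreal
  assumes "a \<le> b"
  shows "a / b \<le> 1"
proof (cases "b = 0 \<or> b = top")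
  case True
  then show ?thesis using assms by (auto simp: ennreal_divide_top)
next
  case False
  then show ?thesis using divide_right_mono_ennreal[OF assms, of b] by (simp add: less_top)
qed

lemma ennreal_inverse_antimono:
  fixes a b :: ennreal
  assumes "a \<le> b"
  shows "inverse b \<le> inverse a"
proof (cases "a = 0 \<or> b = top")
  case False
  then obtain x y where "a = ennreal x" "0 < x" "b = ennreal y" "x \<le> y"
    using assms by (cases a; cases b) (auto simp: less_le top_unique)
  then show ?thesis by (simp add: inverse_ennreal ennreal_leI le_imp_inverse_le)
qed auto

lemma mech_prob_le_one: "mech_prob \<alpha> n k x E \<le> 1"
  unfolding mech_prob_def
  by (intro ennreal_divide_le_one nn_integral_mono) (auto simp: indicator_def)

text \<open>On the event, the distance from the data to the output exceeds \<open>t - d1\<close>,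
  and \<open>dbs k\<close> has volume \<open>1\<close>; this bounds the numerator. Over
  \<open>G\<close> alone the distance is at most \<open>d1 + d2\<close>, which bounds the
  normalising integral from below. The data error \<open>d1\<close> is thus paid twice.\<close>

lemma mech_prob_tail:
  fixes F :: "real ^ 'r \<Rightarrow> real"
  assumes \<alpha>: "0 < \<alpha>" and n: "0 < n" and k: "0 < k" and F: "bounded (range F)"
    and x: "ks_dist F (ecdf n x) \<le> d1"
    and G: "G \<in> sets (leb_k k)" "G \<subseteq> dbs k" "\<And>z. z \<in> G \<Longrightarrow> ks_dist F (ecdf k z) \<le> d2"
    and v: "0 < v" "ennreal v \<le> emeasure (leb_k k) G"
  shows "mech_prob \<alpha> n k x {z. t < ks_dist F (ecdf k z)}
    \<le> ennreal (exp (\<alpha> * n * (2 * d1 + d2 - t) / 2) / v)"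
proof -
  define c where "c = \<alpha> * n / 2"
  have c: "0 < c" using \<alpha> n by (simp add: c_def)
  have g: "g_exp \<alpha> n k x z = exp (- c * ks_dist (ecdf n x) (ecdf k z))" for z
    using n by (simp add: g_exp_def sens_eq[OF n k] c_def field_simps)
  define a where "a = exp (- c * (t - d1))"
  define b where "b = exp (- c * (d1 + d2))"
  let ?num = "\<integral>\<^sup>+ z. indicator (dbs k \<inter> {z. t < ks_dist F (ecdf k z)}) z * ennreal (g_exp \<alpha> n k x z) \<partial>leb_k k"
  let ?den = "\<integral>\<^sup>+ z. indicator (dbs k) z * ennreal (g_exp \<alpha> n k x z) \<partial>leb_k k"
  have "?num \<le> (\<integral>\<^sup>+ z. ennreal a * indicator (dbs k) z \<partial>(leb_k k :: (nat \<Rightarrow> real ^ 'r) measure))"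
  proof (rule nn_integral_mono)
    fix z :: "nat \<Rightarrow> real ^ 'r"
    have "ks_dist F (ecdf k z) \<le> ks_dist F (ecdf n x) + ks_dist (ecdf n x) (ecdf k z)"
      by (intro ks_dist_triangle F ecdf_bounded)
    then have "g_exp \<alpha> n k x z \<le> a" if "t < ks_dist F (ecdf k z)"
      using that x c by (simp add: g a_def)
    then show "indicator (dbs k \<inter> {z. t < ks_dist F (ecdf k z)}) z * ennreal (g_exp \<alpha> n k x z)
        \<le> ennreal a * indicator (dbs k) z"
      by (auto simp: indicator_def ennreal_leI)
  qed
  also have "\<dots> = ennreal a"
    by (subst nn_integral_cmult_indicator) (simp_all add: emeasure_dbs)
  finally have num: "?num \<le> ennreal a" .
  have "ennreal (b * v) \<le> ennreal b * emeasure (leb_k k) G"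
    using v by (simp add: b_def ennreal_mult mult_left_mono)
  also have "\<dots> = (\<integral>\<^sup>+ z. ennreal b * indicator G z \<partial>leb_k k)"
    using G(1) by (rule nn_integral_cmult_indicator[symmetric])
  also have "\<dots> \<le> ?den"
  proof (rule nn_integral_mono)
    fix z :: "nat \<Rightarrow> real ^ 'r"
    have "ks_dist (ecdf n x) (ecdf k z) \<le> ks_dist (ecdf n x) F + ks_dist F (ecdf k z)"
      by (intro ks_dist_triangle F ecdf_bounded)
    then have "b \<le> g_exp \<alpha> n k x z" if "z \<in> G"
      using G(3)[OF that] x c by (simp add: g b_def ks_dist_commute[of "ecdf n x" F])
    then show "ennreal b * indicator G z \<le> indicator (dbs k) z * ennreal (g_exp \<alpha> n k x z)"
      using G(2) by (auto simp: indicator_def ennreal_leI)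
  qed
  finally have den: "ennreal (b * v) \<le> ?den" .
  have "mech_prob \<alpha> n k x {z. t < ks_dist F (ecdf k z)} \<le> ennreal a / ennreal (b * v)"
    unfolding mech_prob_def divide_ennreal_def using num den by (intro mult_mono ennreal_inverse_antimono) auto
  also have "\<dots> = ennreal (a / (b * v))"
    using v by (intro divide_ennreal) (auto simp: a_def b_def)
  also have "a / (b * v) = exp (\<alpha> * n * (2 * d1 + d2 - t) / 2) / v"
  proof -
    have "a = b * exp (\<alpha> * n * (2 * d1 + d2 - t) / 2)"
      unfolding a_def b_def c_def exp_add[symmetric] by (simp add: field_simps)
    then show ?thesis by (simp add: b_def)
  qed
  finally show ?thesis .
qed

text \<open>On \<open>Bad\<close> the conditional probability is estimated trivially by
  \<open>1\<close>, elsewhere by \<open>\<eta>2\<close>.\<close>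

lemma joint_prob_tail:
  fixes P :: "(real ^ 'r) measure"
  assumes P: "prob_space P" and Bad: "Bad \<in> sets (PiM {..<n} (\<lambda>_. P))"
    and bad: "emeasure (PiM {..<n} (\<lambda>_. P)) Bad \<le> ennreal \<eta>1"
    and good: "\<And>x. x \<in> space (PiM {..<n} (\<lambda>_. P)) - Bad \<Longrightarrow> mech_prob \<alpha> n k x E \<le> ennreal \<eta>2"
    and "0 \<le> \<eta>1" "0 \<le> \<eta>2"
  shows "joint_prob P \<alpha> n k E \<le> ennreal (\<eta>1 + \<eta>2)"
proof -
  let ?N = "PiM {..<n} (\<lambda>_. P)"
  interpret N: prob_space ?N by (rule prob_space_PiM) (rule P)
  have "joint_prob P \<alpha> n k E \<le> (\<integral>\<^sup>+ x. indicator Bad x + ennreal \<eta>2 \<partial>?N)"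
    unfolding joint_prob_def
  proof (rule nn_integral_mono)
    fix x assume "x \<in> space ?N"
    then show "mech_prob \<alpha> n k x E \<le> indicator Bad x + ennreal \<eta>2"
      using good[of x] mech_prob_le_one[of \<alpha> n k x E]
      by (cases "x \<in> Bad") (auto intro: add_increasing2)
  qed
  also have "\<dots> = emeasure ?N Bad + ennreal \<eta>2"
    using Bad by (simp add: nn_integral_add N.emeasure_space_1)
  also have "\<dots> \<le> ennreal \<eta>1 + ennreal \<eta>2"
    by (intro add_right_mono bad)
  finally show ?thesis using assms(5,6) by simp
qed

section \<open>Choice of the constants and the final rate\<close>

theorem mainTheorem10:
  fixes P :: "(real ^ 'r) measure"
    and p :: "real ^ 'r \<Rightarrow> real"
    and \<alpha> B :: real
    and k :: "nat \<Rightarrow> nat"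
  assumes alpha_pos: "\<alpha> > 0"
    and p_meas: "p \<in> borel_measurable lborel"
    and p_nonneg: "\<And>x. p x \<ge> 0"
    and P_def: "P = density lborel (\<lambda>x. ennreal (p x * indicator unit_cube x))"
    and P_prob: "prob_space P"
    and p_bdd: "bdd_above (p ` unit_cube)"
    and B_def: "B = ln (SUP x\<in>unit_cube. p x)"
    and B_pos: "B > 0"
    and k_rate: "\<exists>c1 c2 N. 0 < c1 \<and> 0 < c2 \<and> (\<forall>n\<ge>N.
        c1 * ((3 * \<alpha> / B) powr (2/3) * real n powr (2/3)) \<le> real (k n) \<and>
        real (k n) \<le> c2 * ((3 * \<alpha> / B) powr (2/3) * real n powr (2/3)))"
  shows "\<forall>\<eta>>0. \<exists>M N. \<forall>n\<ge>N.
     joint_prob P \<alpha> n (k n)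
       {z. ks_dist (cdf_of P) (ecdf (k n) z) > M * (2 * (B / (3 * \<alpha>)) powr (1/3) * real n powr (-1/3))}
     \<le> ennreal \<eta>"
proof (intro allI impI)
  fix \<eta> :: real assume \<eta>: "\<eta> > 0"
  have setsP: "sets P = sets borel" by (simp add: P_def)
  \<comment> \<open>Since \<open>ln 0 = 0\<close>, positivity of \<open>B\<close> rules out a zero
    supremum, after which \<open>exp\<close> inverts \<open>ln\<close>.\<close>
  have "(SUP x\<in>unit_cube. p x) \<noteq> 0" using B_pos B_def by auto
  moreover have "0 \<le> (SUP x\<in>unit_cube. p x)"
    by (rule cSUP_upper2[OF p_bdd unit_cube_nonempty p_nonneg])
  ultimately have "(SUP x\<in>unit_cube. p x) = exp B" by (simp add: B_def)
  then have p_le: "p x \<le> exp B" if "x \<in> unit_cube" for x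
    using cSUP_upper[OF that p_bdd] by simp
  have dom: "emeasure P A \<le> ennreal (exp B) * emeasure lborel (A \<inter> unit_cube)" if "A \<in> sets borel" for A
    unfolding P_def by (rule emeasure_density_unit_cube_le[OF p_meas p_le that])
  obtain c1 c2 N where c: "0 < c1" "0 < c2" and rate: "\<And>n. n \<ge> N \<Longrightarrow>
      c1 * ((3 * \<alpha> / B) powr (2/3) * real n powr (2/3)) \<le> real (k n) \<and>
      real (k n) \<le> c2 * ((3 * \<alpha> / B) powr (2/3) * real n powr (2/3))"
    using k_rate by blast
  define \<kappa> where "\<kappa> = (3 * \<alpha> / B) powr (2/3)"
  define e0 where "e0 = 2 * (B / (3 * \<alpha>)) powr (1/3)"
  have \<kappa>: "0 < \<kappa>" and e0: "0 < e0" using alpha_pos B_pos by (simp_all add: \<kappa>_def e0_def)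
  \<comment> \<open>The bound \<open>\<eta> / 2\<close> leaves half the allowance to the mechanism;
    \<open>1 / 2\<close> makes at least half of the samples of size \<open>k n\<close> typical,
    which gives the constant in \<open>vol\<close>.\<close>
  define \<eta>' where "\<eta>' = min (\<eta> / 2) (1 / 2)"
  have \<eta>': "0 < \<eta>'" "\<eta>' \<le> \<eta> / 2" "\<eta>' \<le> 1 / 2" using \<eta> by (auto simp: \<eta>'_def)
  obtain C where C: "0 < C" and tail: "\<And>n. 0 < n \<Longrightarrow>
    \<exists>Bad\<in>sets (PiM {..<n} (\<lambda>_. P)). emeasure (PiM {..<n} (\<lambda>_. P)) Bad \<le> ennreal \<eta>' \<and>
    (\<forall>x\<in>space (PiM {..<n} (\<lambda>_. P)) - Bad. ks_dist (cdf_of P) (ecdf n x) \<le> C / sqrt n)"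
    using ks_dist_empirical_O[OF P_prob setsP dom _ \<eta>'(1)] by auto
  have exp_ratio: "exp A / (exp (- D) / 2) = 2 * exp (D + A)" for A D :: real
    by (simp add: exp_add exp_minus field_simps)
  \<comment> \<open>In units of \<open>1 / u\<close>, with \<open>u\<close> the cube root of
    \<open>n\<close>, \<open>a\<close> bounds \<open>2 * d1 + d2\<close>; \<open>l\<close> solves
    \<open>2 * exp (- l) = \<eta> / 2\<close>. \<open>M\<close> is chosen so that the gain
    \<open>\<alpha> * n * (t - a / u) / 2\<close> pays for the volume cost
    \<open>c2 * \<kappa> * B * u^2\<close> and for \<open>l\<close>. The maximum is there because
    \<open>l\<close> is negative when \<open>\<eta> > 4\<close>.\<close>
  define a where "a = 2 * C + C / sqrt (c1 * \<kappa>)"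
  define l where "l = ln (4 / \<eta>)"
  define M where "M = (a + 2 * (c2 * \<kappa> * B + max l 0) / \<alpha>) / e0"
  have "joint_prob P \<alpha> n (k n)
       {z. ks_dist (cdf_of P) (ecdf (k n) z) > M * (2 * (B / (3 * \<alpha>)) powr (1/3) * real n powr (-1/3))}
     \<le> ennreal \<eta>" if n: "n \<ge> max N 1" for n
  proof -
    \<comment> \<open>All quantities become integer powers of \<open>u\<close>:
      \<open>n = u ^ 3\<close>, \<open>k n\<close> has order \<open>u^2\<close>, and the rate has
      order \<open>1 / u\<close>.\<close>
    define u where "u = real n powr (1/3)"
    have n0: "0 < n" and nN: "n \<ge> N" using n by auto
    have u: "1 \<le> u" using n0 by (simp add: u_def ge_one_powr_ge_zero)
    have u2: "real n powr (2/3) = u\<^sup>2" using n0 by (simp add: u_def powr_power)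
    have u3: "real n = u ^ 3" using n0 by (simp add: u_def powr_power)
    have um: "real n powr (-1/3) = 1 / u" using n0 by (simp add: u_def powr_minus_divide)
    have k: "c1 * \<kappa> * u\<^sup>2 \<le> k n" "k n \<le> c2 * \<kappa> * u\<^sup>2"
      using rate[OF nN] by (simp_all add: u2 \<kappa>_def mult.assoc)
    have k0: "0 < k n"
      using k(1) c \<kappa> u by (cases "k n = 0") (auto simp: mult_le_0_iff not_le)
    define t where "t = M * e0 / u"
    have t: "M * (2 * (B / (3 * \<alpha>)) powr (1/3) * real n powr (-1/3)) = t"
      by (simp add: t_def e0_def um[simplified])
    obtain Bn where Bn: "Bn \<in> sets (PiM {..<n} (\<lambda>_. P))"
      "emeasure (PiM {..<n} (\<lambda>_. P)) Bn \<le> ennreal \<eta>'"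
      "\<And>x. x \<in> space (PiM {..<n} (\<lambda>_. P)) - Bn \<Longrightarrow> ks_dist (cdf_of P) (ecdf n x) \<le> C / sqrt n"
      using tail[OF n0] by auto
    \<comment> \<open>A fictitious sample of size \<open>k n\<close> from \<open>P\<close>,
      introduced only to find a large volume of outputs close to the true cdf.\<close>
    obtain Bk where Bk: "Bk \<in> sets (PiM {..<k n} (\<lambda>_. P))"
      "emeasure (PiM {..<k n} (\<lambda>_. P)) Bk \<le> ennreal \<eta>'"
      "\<And>z. z \<in> space (PiM {..<k n} (\<lambda>_. P)) - Bk \<Longrightarrow> ks_dist (cdf_of P) (ecdf (k n) z) \<le> C / sqrt (k n)"
      using tail[OF k0] by auto
    let ?K = "PiM {..<k n} (\<lambda>_. P)"
    interpret K: prob_space ?K by (rule prob_space_PiM) (rule P_prob)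
    have setsK: "sets ?K = sets (leb_k (k n))"
      unfolding leb_k_def by (rule sets_PiM_cong) (auto simp: setsP)
    define G where "G = (space ?K - Bk) \<inter> dbs (k n)"
    have "space ?K - Bk \<in> sets (leb_k (k n))"
      using sets.compl_sets[OF Bk(1)] by (simp only: setsK)
    then have G: "G \<in> sets (leb_k (k n))" "G \<subseteq> dbs (k n)"
      unfolding G_def using dbs_sets[of "k n"] by (rule sets.Int) (rule Int_lower2)
    have vol: "ennreal (exp (- B * k n) / 2) \<le> emeasure (leb_k (k n)) G"
    proof -
      have "K.prob Bk \<le> 1 / 2"
        using Bk(2) \<eta>' by (simp add: K.emeasure_eq_measure)
      then have "1 / 2 \<le> K.prob (space ?K - Bk)"
        using Bk(1) by (simp add: K.prob_compl)
      then have "ennreal (1 / 2) \<le> emeasure ?K (space ?K - Bk)"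
        unfolding K.emeasure_eq_measure by (rule ennreal_leI)
      also have "\<dots> \<le> ennreal (exp B ^ k n) * emeasure (leb_k (k n)) G"
        unfolding G_def P_def
        by (rule emeasure_PiM_density_unit_cube_le[OF p_meas p_le])
           (use P_prob Bk(1) in \<open>auto simp: P_def[symmetric]\<close>)
      finally have "ennreal (exp (- B * k n)) * ennreal (1 / 2)
          \<le> ennreal (exp (- B * k n)) * (ennreal (exp B ^ k n) * emeasure (leb_k (k n)) G)"
        by (rule mult_left_mono) simp
      moreover have "ennreal (exp (- B * k n)) * ennreal (exp B ^ k n) = 1"
        by (simp add: mult.commute[of B] flip: ennreal_mult exp_of_nat_mult exp_add)
      moreover have "ennreal (exp (- B * k n)) * ennreal (1 / 2) = ennreal (exp (- B * k n) / 2)"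
        by (subst ennreal_mult[symmetric]) simp_all
      ultimately show ?thesis
        by (simp only: mult.assoc[symmetric] mult_1_left)
    qed
    \<comment> \<open>Here \<open>sqrt n\<close> is \<open>u\<close> to the power
      \<open>3/2\<close>; the cruder \<open>u\<close> suffices because the output error already has
      order \<open>1 / u\<close>.\<close>
    have d1: "C / sqrt n \<le> C / u"
    proof -
      have "u\<^sup>2 \<le> real n" unfolding u3 using u by (intro power_increasing) auto
      then have "u \<le> sqrt n" by (rule real_le_rsqrt)
      then show ?thesis using C u n0 by (intro divide_left_mono) auto
    qed
    have d2: "C / sqrt (k n) \<le> C / sqrt (c1 * \<kappa>) / u"
    proof -
      have "sqrt (c1 * \<kappa>) * u = sqrt (c1 * \<kappa> * u\<^sup>2)"
        using u by (simp add: real_sqrt_mult)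
      also have "\<dots> \<le> sqrt (k n)" using k(1) by (rule real_sqrt_le_mono)
      finally show ?thesis
        using C c \<kappa> u k0 unfolding divide_divide_eq_left
        by (intro divide_left_mono mult_pos_pos) auto
    qed
    have mech: "mech_prob \<alpha> n (k n) x {z. t < ks_dist (cdf_of P) (ecdf (k n) z)} \<le> ennreal (\<eta> / 2)"
      if x: "x \<in> space (PiM {..<n} (\<lambda>_. P)) - Bn" for x
    proof -
      have "mech_prob \<alpha> n (k n) x {z. t < ks_dist (cdf_of P) (ecdf (k n) z)}
          \<le> ennreal (exp (\<alpha> * n * (2 * (C / u) + C / sqrt (c1 * \<kappa>) / u - t) / 2) / (exp (- B * k n) / 2))"
        by (rule mech_prob_tail[OF alpha_pos n0 k0 cdf_of_bounded[OF P_prob] _ G _ _ vol])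
           (use Bn(3)[OF x] Bk(3) d1 d2 in \<open>auto simp: G_def intro: order_trans\<close>)
      also have "exp (\<alpha> * n * (2 * (C / u) + C / sqrt (c1 * \<kappa>) / u - t) / 2) / (exp (- B * k n) / 2)
          = 2 * exp (B * k n + \<alpha> * n * (2 * (C / u) + C / sqrt (c1 * \<kappa>) / u - t) / 2)"
        unfolding mult_minus_left by (rule exp_ratio)
      also have "\<dots> \<le> 2 * exp (- l)"
      proof -
        have "2 * (C / u) + C / sqrt (c1 * \<kappa>) / u - t = (a - M * e0) / u"
          by (simp add: a_def t_def diff_divide_distrib add_divide_distrib)
        also have "\<dots> = - (2 * (c2 * \<kappa> * B + max l 0) / \<alpha>) / u"
          using e0 by (simp add: M_def)
        finally have diff: "2 * (C / u) + C / sqrt (c1 * \<kappa>) / u - t = \<dots>" .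
        have "\<alpha> * n * (2 * (C / u) + C / sqrt (c1 * \<kappa>) / u - t) / 2 = - (c2 * \<kappa> * B + max l 0) * u\<^sup>2"
          unfolding diff using alpha_pos u by (simp add: u3 field_simps power2_eq_square power3_eq_cube)
        moreover have "B * k n \<le> B * (c2 * \<kappa> * u\<^sup>2)"
          using k(2) B_pos by (intro mult_left_mono) auto
        moreover have "max l 0 * 1 \<le> max l 0 * u\<^sup>2"
          using u by (intro mult_left_mono) (auto simp: one_le_power)
        ultimately have "B * k n + \<alpha> * n * (2 * (C / u) + C / sqrt (c1 * \<kappa>) / u - t) / 2 \<le> - l"
          by (simp add: algebra_simps)
        then show ?thesis by simp
      qed
      also have "\<dots> = \<eta> / 2" using \<eta> by (simp add: l_def exp_minus)
      finally show ?thesis by (simp add: ennreal_leI)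
    qed
    have "joint_prob P \<alpha> n (k n) {z. t < ks_dist (cdf_of P) (ecdf (k n) z)} \<le> ennreal (\<eta>' + \<eta> / 2)"
      by (rule joint_prob_tail[OF P_prob Bn(1,2) mech]) (use \<eta> \<eta>' in auto)
    also have "\<dots> \<le> ennreal \<eta>" using \<eta>' by (intro ennreal_leI) simp
    finally show ?thesis unfolding t .
  qed
  then show "\<exists>M N. \<forall>n\<ge>N.
     joint_prob P \<alpha> n (k n)
       {z. ks_dist (cdf_of P) (ecdf (k n) z) > M * (2 * (B / (3 * \<alpha>)) powr (1/3) * real n powr (-1/3))}
     \<le> ennreal \<eta>" by blast
qed

end
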